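(* Let $A$ be a real $m\times n$ matrix with $A^\top A=\mathbf{I}_n$, $m\ge n$, and let $0<\varepsilon<1$. There is a deterministic algorithm that returns at most $t=\mathcal{O}(n\ln n/\varepsilon^2)$ indices $x_1^*,\ldots,x_t^*\in[m]$ with corresponding scalars $s_1,\ldots,s_t$, using $\widetilde{\mathcal{O}}(mn^2\log^3n/\varepsilon^2)$ operations, such that $$\Big\|\sum_{i=1}^t s_i\,A_{(x_i^* )}\otimes A_{(x_i^* )}-\mathbf{I}_n\Big\|\le\varepsilon.$$
   Context: $A_{(i)}$ denotes the $i$-th row of $A$ (viewed as a vector in $\mathbb{R}^n$); for $x\in\mathbb{R}^n$, $x\otimes x$ is the $n\times n$ matrix with entries $x_ix_j$. $\|\cdot\|$ is the operator norm. The $\widetilde{\mathcal{O}}(\cdot)$ notation hides $\log\log n$ and $\log\log(1/\varepsilon)$ factors. *)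

theory Defs
  imports Complex_Main "Jordan_Normal_Form.Matrix"
begin

section \<open>Outer products, finite sums of matrices, operator norm\<close>

definition outer_product :: "real vec \<Rightarrow> real mat" where
  "outer_product x = mat (dim_vec x) (dim_vec x) (\<lambda>(i, j). x $ i * x $ j)"

text \<open>Matrices of varying dimension do not form a monoid type class, so the sum of
  \<open>n \<times> n\<close> matrices is written out entrywise.\<close>

definition square_mat_sum :: "nat \<Rightarrow> (nat \<Rightarrow> real mat) \<Rightarrow> nat set \<Rightarrow> real mat" where
  "square_mat_sum n F I = mat n n (\<lambda>(p, q). \<Sum>i\<in>I. F i $$ (p, q))"

definition euclidean_norm :: "real vec \<Rightarrow> real" where
  "euclidean_norm v = sqrt (v \<bullet> v)"

definition operator_norm :: "real mat \<Rightarrow> real" where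
  "operator_norm M =
     (SUP v \<in> {v \<in> carrier_vec (dim_col M). euclidean_norm v \<le> 1}. euclidean_norm (M *\<^sub>v v))"

section \<open>Deterministic algorithms: a uniform real random access machine\<close>

text \<open>Programs are finite pieces of syntax over two kinds of memory: named one-dimensional
  arrays of natural numbers (used for addressing, counting and returning indices) and named
  two-dimensional arrays of exact real numbers. The only operations on reals are
  \<open>+\<close>, \<open>-\<close>, \<open>*\<close>, \<open>/\<close>, \<open><\<close>, integer literals and the conversion of a
  natural number; there is no rounding from reals to integers. Natural numbers can only be added,
  (truncatedly) subtracted and compared, so unit cost arithmetic on them cannot be abused.
  Division by zero yields zero, which a program could equally well test for.\<close>

datatype nexp =
    NLit nat
  | NCell string nexp
  | NAdd nexp nexp
  | NSub nexp nexp

datatype rexp =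
    RLit int
  | RNat nexp
  | RCell string nexp nexp
  | RAdd rexp rexp
  | RSub rexp rexp
  | RMul rexp rexp
  | RDiv rexp rexp

datatype bexp =
    BLessN nexp nexp
  | BLessR rexp rexp
  | BNot bexp
  | BAnd bexp bexp

datatype program =
    Skip
  | AssignN string nexp nexp
  | AssignR string nexp nexp rexp
  | Seq program program
  | Cond bexp program program
  | Loop bexp program

record memory =
  nat_mem :: "string \<Rightarrow> nat \<Rightarrow> nat"
  real_mem :: "string \<Rightarrow> nat \<Rightarrow> nat \<Rightarrow> real"

fun nval :: "memory \<Rightarrow> nexp \<Rightarrow> nat" where
  "nval s (NLit k) = k"
| "nval s (NCell x a) = nat_mem s x (nval s a)"
| "nval s (NAdd a b) = nval s a + nval s b"
| "nval s (NSub a b) = nval s a - nval s b"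

fun rval :: "memory \<Rightarrow> rexp \<Rightarrow> real" where
  "rval s (RLit k) = of_int k"
| "rval s (RNat a) = real (nval s a)"
| "rval s (RCell x a b) = real_mem s x (nval s a) (nval s b)"
| "rval s (RAdd a b) = rval s a + rval s b"
| "rval s (RSub a b) = rval s a - rval s b"
| "rval s (RMul a b) = rval s a * rval s b"
| "rval s (RDiv a b) = rval s a / rval s b"

fun bval :: "memory \<Rightarrow> bexp \<Rightarrow> bool" where
  "bval s (BLessN a b) \<longleftrightarrow> nval s a < nval s b"
| "bval s (BLessR a b) \<longleftrightarrow> rval s a < rval s b"
| "bval s (BNot b) \<longleftrightarrow> \<not> bval s b"
| "bval s (BAnd a b) \<longleftrightarrow> bval s a \<and> bval s b"

text \<open>The cost of evaluating an expression is its number of nodes: every literal, memory access,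
  arithmetic operation, comparison and connective counts one.\<close>

fun ncost :: "nexp \<Rightarrow> nat" where
  "ncost (NLit k) = 1"
| "ncost (NCell x a) = 1 + ncost a"
| "ncost (NAdd a b) = 1 + ncost a + ncost b"
| "ncost (NSub a b) = 1 + ncost a + ncost b"

fun rcost :: "rexp \<Rightarrow> nat" where
  "rcost (RLit k) = 1"
| "rcost (RNat a) = 1 + ncost a"
| "rcost (RCell x a b) = 1 + ncost a + ncost b"
| "rcost (RAdd a b) = 1 + rcost a + rcost b"
| "rcost (RSub a b) = 1 + rcost a + rcost b"
| "rcost (RMul a b) = 1 + rcost a + rcost b"
| "rcost (RDiv a b) = 1 + rcost a + rcost b"

fun bcost :: "bexp \<Rightarrow> nat" where
  "bcost (BLessN a b) = 1 + ncost a + ncost b"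
| "bcost (BLessR a b) = 1 + rcost a + rcost b"
| "bcost (BNot b) = 1 + bcost b"
| "bcost (BAnd a b) = 1 + bcost a + bcost b"

definition write_nat :: "string \<Rightarrow> nat \<Rightarrow> nat \<Rightarrow> memory \<Rightarrow> memory" where
  "write_nat x i k s = s\<lparr>nat_mem := (nat_mem s)(x := (nat_mem s x)(i := k))\<rparr>"

definition write_real :: "string \<Rightarrow> nat \<Rightarrow> nat \<Rightarrow> real \<Rightarrow> memory \<Rightarrow> memory" where
  "write_real x i j r s =
     s\<lparr>real_mem := (real_mem s)(x := (real_mem s x)(i := (real_mem s x i)(j := r)))\<rparr>"

text \<open>\<open>runs c s T s'\<close>: started in \<open>s\<close>, the program \<open>c\<close> terminates in \<open>s'\<close> after exactly
  \<open>T\<close> operations.\<close>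

inductive runs :: "program \<Rightarrow> memory \<Rightarrow> nat \<Rightarrow> memory \<Rightarrow> bool" where
  Skip: "runs Skip s 1 s"
| AssignN: "runs (AssignN x a e) s (1 + ncost a + ncost e) (write_nat x (nval s a) (nval s e) s)"
| AssignR: "runs (AssignR x a b e) s (1 + ncost a + ncost b + rcost e)
              (write_real x (nval s a) (nval s b) (rval s e) s)"
| Seq: "runs c s T s' \<Longrightarrow> runs d s' T' s'' \<Longrightarrow> runs (Seq c d) s (T + T') s''"
| CondTrue: "bval s b \<Longrightarrow> runs c s T s' \<Longrightarrow> runs (Cond b c d) s (1 + bcost b + T) s'"
| CondFalse: "\<not> bval s b \<Longrightarrow> runs d s T s' \<Longrightarrow> runs (Cond b c d) s (1 + bcost b + T) s'"
| LoopFalse: "\<not> bval s b \<Longrightarrow> runs (Loop b c) s (1 + bcost b) s"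
| LoopTrue: "bval s b \<Longrightarrow> runs c s T s' \<Longrightarrow> runs (Loop b c) s' T' s'' \<Longrightarrow>
               runs (Loop b c) s (1 + bcost b + T + T') s''"

inductive_cases runs_SkipE: "runs Skip s T s'"
inductive_cases runs_AssignNE: "runs (AssignN x a e) s T s'"
inductive_cases runs_AssignRE: "runs (AssignR x a b e) s T s'"
inductive_cases runs_SeqE: "runs (Seq c d) s T s'"
inductive_cases runs_CondE: "runs (Cond b c d) s T s'"
inductive_cases runs_LoopE: "runs (Loop b c) s T s'"

lemma runs_deterministic:
  "runs c s T s' \<Longrightarrow> runs c s U u \<Longrightarrow> U = T \<and> u = s'"
proof (induction arbitrary: U u rule: runs.induct)
  case Skip from Skip.prems show ?case
    by (rule runs_SkipE) auto
next
  case AssignN from AssignN.prems show ?case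
    by (rule runs_AssignNE) auto
next
  case AssignR from AssignR.prems show ?case
    by (rule runs_AssignRE) auto
next
  case Seq from Seq.prems show ?case
    by (rule runs_SeqE) (use Seq.hyps in \<open>auto dest: Seq.IH\<close>)
next
  case CondTrue from CondTrue.prems show ?case
    by (rule runs_CondE) (use CondTrue.hyps in \<open>auto dest: CondTrue.IH\<close>)
next
  case CondFalse from CondFalse.prems show ?case
    by (rule runs_CondE) (use CondFalse.hyps in \<open>auto dest: CondFalse.IH\<close>)
next
  case LoopFalse from LoopFalse.prems show ?case
    by (rule runs_LoopE) (use LoopFalse in auto)
next
  case LoopTrue from LoopTrue.prems show ?case
    by (rule runs_LoopE) (use LoopTrue.hyps in \<open>auto dest: LoopTrue.IH\<close>)
qed

text \<open>The input is \<open>m\<close>, \<open>n\<close>, the entries of \<open>A\<close> and \<open>\<epsilon>\<close>; all other memory is zero. In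
  particular one program serves all dimensions and accuracies.\<close>

definition input_memory :: "nat \<Rightarrow> nat \<Rightarrow> real mat \<Rightarrow> real \<Rightarrow> memory" where
  "input_memory m n A \<epsilon> =
     \<lparr>nat_mem = (\<lambda>x i. if x = ''m'' \<and> i = 0 then m else if x = ''n'' \<and> i = 0 then n else 0),
      real_mem = (\<lambda>x i j. if x = ''A'' \<and> i < m \<and> j < n then A $$ (i, j)
                          else if x = ''eps'' \<and> i = 0 \<and> j = 0 then \<epsilon> else 0)\<rparr>"

definition output_length :: "memory \<Rightarrow> nat" where
  "output_length s = nat_mem s ''t'' 0"

definition output_index :: "memory \<Rightarrow> nat \<Rightarrow> nat" where
  "output_index s i = nat_mem s ''x'' i"

definition output_scalar :: "memory \<Rightarrow> nat \<Rightarrow> real" where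
  "output_scalar s i = real_mem s ''s'' i 0"

section \<open>Logarithmic factors in complexity bounds\<close>

text \<open>Inside asymptotic bounds logarithms are clipped from below at \<open>1\<close>. This changes
  \<open>ln x\<close> for \<open>x \<ge> 2\<close> by at most a constant factor, and keeps the bounds meaningful where the
  literal expression vanishes or is undefined (\<open>ln 1\<close>, or \<open>ln (ln (1 / \<epsilon>))\<close> for \<open>\<epsilon>\<close> near \<open>1\<close>).\<close>

definition log_factor :: "real \<Rightarrow> real" where
  "log_factor x = max 1 (ln x)"

definition loglog_factor :: "real \<Rightarrow> real" where
  "loglog_factor x = log_factor (log_factor x)"

end

theory Submission
  imports Defs
begin

text \<open>Derandomized online sampling with two barriers, as in Batson-Spielman-Srivastava sparsification.
  Write \<open>a\<^sub>i\<close> for the rows of \<open>A\<close>, \<open>\<delta> = \<epsilon> / 2\<close>, \<open>S\<^sub>i\<close> for the sum of \<open>a\<^sub>j \<otimes> a\<^sub>j\<close> over \<open>j < i\<close> and \<open>M\<close> for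
  the weighted sample chosen so far. The rows are visited once, keeping
  \<open>-\<delta> I + (1 - \<delta>) S\<^sub>i \<prec> M \<prec> \<delta> I + (1 + \<delta>) S\<^sub>i\<close>; since \<open>S\<^sub>m = I\<close>, the final error is at most \<open>2 \<delta>\<close>.
  Let \<open>Y\<close> and \<open>Z\<close> be the inverses of the distances to the upper and the lower barrier. If row \<open>i\<close> were
  kept with weight \<open>1 / p\<close> with probability \<open>p = min 1 (2 / \<delta> (a\<^sub>i\<^sup>T Y a\<^sub>i + a\<^sub>i\<^sup>T Z a\<^sub>i))\<close>, the barriers could
  never be crossed, and \<open>Y\<close> and \<open>Z\<close> would not increase in expectation, so that the expected size of the
  sample would be at most \<open>2 / \<delta>\<close> times the initial trace of \<open>Y + Z\<close>, that is \<open>4 n / \<delta>\<^sup>2\<close>. The method of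
  conditional expectations makes the choices deterministic. All updates have rank one, hence a row
  costs \<open>O(n\<^sup>2)\<close> operations and the whole computation \<open>O(m n\<^sup>2)\<close>; no logarithmic factor is lost.\<close>

section \<open>Inverse barriers under rank-one updates\<close>

definition ip :: "nat \<Rightarrow> (nat \<Rightarrow> real) \<Rightarrow> (nat \<Rightarrow> real) \<Rightarrow> real" where
  "ip n u v = (\<Sum>p<n. u p * v p)"

text \<open>Vectors and matrices are plain functions on indices, as the arrays of the machine are,
  so that memory contents can be inserted directly; only indices below \<open>n\<close>
  count.\<close>

definition bil :: "nat \<Rightarrow> (nat \<Rightarrow> nat \<Rightarrow> real) \<Rightarrow> (nat \<Rightarrow> real) \<Rightarrow> (nat \<Rightarrow> real) \<Rightarrow> real" where
  "bil n Y u v = (\<Sum>p<n. \<Sum>q<n. Y p q * u p * v q)"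

lemma bil_add_right: "bil n Y u (\<lambda>p. v p + c * w p) = bil n Y u v + c * bil n Y u w"
  by (simp add: bil_def algebra_simps sum.distrib sum_distrib_left)

lemma bil_add_left: "bil n Y (\<lambda>p. v p + c * w p) u = bil n Y v u + c * bil n Y w u"
  by (simp add: bil_def algebra_simps sum.distrib sum_distrib_left)

lemma bil_commute:
  assumes "\<And>p q. p < n \<Longrightarrow> q < n \<Longrightarrow> Y p q = Y q p"
  shows "bil n Y u v = bil n Y v u"
  unfolding bil_def by (subst sum.swap) (auto intro!: sum.cong simp: assms)

lemma bil_conv_ip: "bil n Y u v = ip n u (\<lambda>p. \<Sum>q<n. Y p q * v q)"
  by (simp add: bil_def ip_def sum_distrib_left mult_ac)

lemma bil_rank_one:
  assumes "\<And>p q. p < n \<Longrightarrow> q < n \<Longrightarrow> Y' p q = Y p q + c * y p * y q"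
  shows "bil n Y' u v = bil n Y u v + c * ip n u y * ip n v y"
proof -
  have "bil n Y' u v = (\<Sum>p<n. \<Sum>q<n. Y p q * u p * v q + c * ((u p * y p) * (v q * y q)))"
    unfolding bil_def by (intro sum.cong refl) (simp add: assms algebra_simps)
  also have "\<dots> = bil n Y u v + c * (ip n u y * ip n v y)"
    by (simp add: bil_def ip_def sum.distrib sum_product) (simp add: sum_distrib_left)
  finally show ?thesis by (simp add: mult.assoc)
qed

text \<open>The form at \<open>u + c v\<close> is a nonnegative polynomial in \<open>c\<close>. Its
  minimizer gives the inequality; if the form vanishes at \<open>v\<close>, the polynomial is affine
  in \<open>c\<close>, hence constant.\<close>

lemma bil_Cauchy_Schwarz:
  assumes sym: "\<And>p q. p < n \<Longrightarrow> q < n \<Longrightarrow> Y p q = Y q p" and psd: "\<And>v. 0 \<le> bil n Y v v"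
  shows "(bil n Y u v)\<^sup>2 \<le> bil n Y u u * bil n Y v v"
proof -
  have quad: "0 \<le> bil n Y u u + 2 * c * bil n Y u v + c\<^sup>2 * bil n Y v v" for c
    using psd[of "\<lambda>p. u p + c * v p"] bil_commute[of n Y u v, OF sym]
    by (simp add: bil_add_right bil_add_left power2_eq_square algebra_simps)
  show ?thesis
  proof (cases "bil n Y v v = 0")
    case True
    have "bil n Y u v = 0"
    proof (rule ccontr)
      assume nz: "bil n Y u v \<noteq> 0"
      define c where "c = - (bil n Y u u + 1) / (2 * bil n Y u v)"
      have "2 * c * bil n Y u v = - (bil n Y u u + 1)" using nz by (simp add: c_def)
      with quad[of c] True show False by simp
    qed
    with True show ?thesis by simp
  next
    case False
    with psd[of v] have pos: "0 < bil n Y v v" by simp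
    have "0 \<le> bil n Y u u - (bil n Y u v)\<^sup>2 / bil n Y v v"
      using quad[of "- bil n Y u v / bil n Y v v"] False by (simp add: power2_eq_square)
    with pos show ?thesis by (simp add: pos_divide_le_eq)
  qed
qed

text \<open>\<open>Y\<close> is the inverse of the positive definite operator \<open>L\<close>.\<close>

definition barrier :: "nat \<Rightarrow> (nat \<Rightarrow> nat \<Rightarrow> real) \<Rightarrow> ((nat \<Rightarrow> real) \<Rightarrow> nat \<Rightarrow> real) \<Rightarrow> bool" where
  "barrier n Y L \<longleftrightarrow> (\<forall>p<n. \<forall>q<n. Y p q = Y q p) \<and> (\<forall>v. 0 \<le> bil n Y v v) \<and>
     (\<forall>u v. bil n Y u (L v) = ip n u v)"

text \<open>Taking \<open>u = L v\<close> in the inverse relation turns the form of \<open>L\<close>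
  at \<open>v\<close> into the form of \<open>Y\<close> at \<open>L v\<close>. In this way an
  inverse certifies that a barrier has not been crossed.\<close>

lemma barrier_psd:
  assumes "barrier n Y L" shows "0 \<le> ip n (L v) v"
  using assms unfolding barrier_def by metis

text \<open>Sherman-Morrison formula: adding a multiple of \<open>a \<otimes> a\<close> to an
  operator changes its inverse by a multiple of \<open>Y a \<otimes> Y a\<close>. The second claim
  is what the update of the estimator rests on.\<close>

lemma barrier_sherman_morrison:
  assumes bar: "barrier n Y L" and pos: "0 < 1 + \<gamma> * bil n Y a a"
    and y: "\<And>p. p < n \<Longrightarrow> y p = (\<Sum>q<n. Y p q * a q)"
    and Y': "\<And>p q. p < n \<Longrightarrow> q < n \<Longrightarrow> Y' p q = Y p q - \<gamma> / (1 + \<gamma> * bil n Y a a) * y p * y q"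
    and L': "\<And>v. L' v = (\<lambda>p. L v p + \<gamma> * ip n a v * a p)"
  shows "barrier n Y' L'"
    and "bil n Y' u u = bil n Y u u - \<gamma> / (1 + \<gamma> * bil n Y a a) * (ip n u y)\<^sup>2"
proof -
  let ?s = "bil n Y a a"
  define g where "g = \<gamma> / (1 + \<gamma> * ?s)"
  from bar have sym: "\<And>p q. p < n \<Longrightarrow> q < n \<Longrightarrow> Y p q = Y q p" and psd: "\<And>v. 0 \<le> bil n Y v v"
    and inv: "\<And>u v. bil n Y u (L v) = ip n u v" by (auto simp: barrier_def)
  have ip_y: "ip n u y = bil n Y u a" for u
    unfolding bil_conv_ip by (auto simp: ip_def y)
  have bil': "bil n Y' u v = bil n Y u v - g * bil n Y u a * bil n Y v a" for u v
    using bil_rank_one[of n Y' Y "- g" y u v] Y' by (simp add: ip_y g_def)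
  show "bil n Y' u u = bil n Y u u - \<gamma> / (1 + \<gamma> * bil n Y a a) * (ip n u y)\<^sup>2"
    by (simp add: bil' ip_y g_def power2_eq_square)
  have "0 \<le> bil n Y' v v" for v
  proof -
    \<comment> \<open>Only for \<gamma> \<ge> 0 can the correction lower the form, and then
      Cauchy-Schwarz bounds the loss, since \<open>\<gamma> s / (1 + \<gamma> s)\<close> is at most
      1 for \<open>s = bil n Y a a\<close>. For negative \<gamma> the correction can only raise
      it.\<close>
    have "g * (bil n Y v a)\<^sup>2 \<le> bil n Y v v"
    proof (cases "0 \<le> \<gamma>")
      case True
      have "g * (bil n Y v a)\<^sup>2 \<le> g * (bil n Y v v * ?s)"
        using bil_Cauchy_Schwarz[OF sym psd, of v a] True pos by (intro mult_left_mono) (auto simp: g_def)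
      also have "\<dots> = (g * ?s) * bil n Y v v" by simp
      also have "\<dots> \<le> 1 * bil n Y v v"
        using pos psd[of v] by (intro mult_right_mono) (auto simp: g_def)
      finally show ?thesis by simp
    next
      case False
      then have "g \<le> 0" using pos by (simp add: g_def divide_nonpos_pos)
      then have "g * (bil n Y v a)\<^sup>2 \<le> 0" by (simp add: mult_nonpos_nonneg)
      then show ?thesis using psd[of v] by linarith
    qed
    then show ?thesis by (simp add: bil' power2_eq_square mult.assoc)
  qed
  moreover have "bil n Y' u (L' v) = ip n u v" for u v
  proof -
    have a: "bil n Y (L' v) a = ip n a v + \<gamma> * ip n a v * ?s"
      by (subst bil_commute[of n Y, OF sym]) (simp_all add: L' bil_add_right inv)
    have "bil n Y' u (L' v) = ip n u v + \<gamma> * ip n a v * bil n Y u a - g * bil n Y u a * (ip n a v + \<gamma> * ip n a v * ?s)"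
      unfolding bil' a by (simp add: L' bil_add_right inv)
    also have "\<dots> = ip n u v + ip n a v * bil n Y u a * (\<gamma> - g * (1 + \<gamma> * ?s))"
      by (simp add: algebra_simps)
    also have "\<gamma> - g * (1 + \<gamma> * ?s) = 0" using pos by (simp add: g_def)
    finally show ?thesis by simp
  qed
  moreover have "Y' p q = Y' q p" if "p < n" "q < n" for p q
    using that by (simp add: Y' sym[of p q])
  ultimately show "barrier n Y' L'" by (auto simp: barrier_def)
qed

section \<open>Sherman-Morrison coefficients and the choice for a single row\<close>

definition gain :: "real \<Rightarrow> real \<Rightarrow> real" where
  "gain \<gamma> s = \<gamma> / (1 + \<gamma> * s)"

lemma gain_average:
  assumes "1 + x * s \<noteq> 0" "1 + y * s \<noteq> 0"
  shows "p * gain x s + (1 - p) * gain y s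
    = (p * x * (1 + y * s) + (1 - p) * y * (1 + x * s)) / ((1 + x * s) * (1 + y * s))"
  using assms by (simp add: gain_def add_frac_eq)

text \<open>\<open>p\<close> is the probability of a fictitious random choice between \<open>w = 1 / p\<close> and \<open>w = 0\<close>, under
  which the two inverses do not increase in expectation.\<close>

lemma gain_upper:
  assumes "0 < p" "p < 1" "0 \<le> s" "2 * s \<le> \<delta> * p" "0 < \<delta>" "\<delta> < 1"
  shows "0 < 1 + (1 + \<delta> - 1 / p) * s" "0 < 1 + (1 + \<delta>) * s"
    and "0 \<le> p * gain (1 + \<delta> - 1 / p) s + (1 - p) * gain (1 + \<delta>) s"
proof -
  have sp: "s / p \<le> \<delta> / 2" using assms by (simp add: field_simps)
  have d1: "1 + (1 + \<delta> - 1 / p) * s = 1 + (1 + \<delta>) * s - s / p" by (simp add: algebra_simps)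
  show p1: "0 < 1 + (1 + \<delta>) * s" using assms by (simp add: add_pos_nonneg)
  have "0 \<le> (1 + \<delta>) * s" using assms by simp
  then show p2: "0 < 1 + (1 + \<delta> - 1 / p) * s" unfolding d1 using sp assms by linarith
  let ?e = "1 + \<delta>"
  \<comment> \<open>With \<open>x = 1 + \<delta> - 1 / p\<close> for keeping and
    \<open>y = 1 + \<delta>\<close> for skipping, the numerator of the average is
    \<open>p x + (1 - p) y + x y s\<close>, and \<open>p x + (1 - p) y = \<delta>\<close>. The
    negative part of \<open>x y s\<close> is at most \<delta> because
    \<open>s / p \<le> \<delta> / 2\<close>; this is what fixes the factor
    \<open>2 / \<delta>\<close> in the probability.\<close>
  have "?e * (s / p) \<le> 2 * (\<delta> / 2)" using sp assms by (intro mult_mono) auto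
  moreover have "0 \<le> ?e\<^sup>2 * s" using assms by simp
  ultimately have key: "0 \<le> \<delta> - ?e * (s / p) + ?e\<^sup>2 * s" using assms(5) by linarith
  have "p * gain (?e - 1 / p) s + (1 - p) * gain ?e s
     = (p * (?e - 1 / p) * (1 + ?e * s) + (1 - p) * ?e * (1 + (?e - 1 / p) * s))
       / ((1 + (?e - 1 / p) * s) * (1 + ?e * s))"
    using p1 p2 by (intro gain_average) auto
  also have "p * (?e - 1 / p) * (1 + ?e * s) + (1 - p) * ?e * (1 + (?e - 1 / p) * s)
     = \<delta> - ?e * (s / p) + ?e\<^sup>2 * s"
    using assms(1) by (simp add: field_simps power2_eq_square)
  finally show "0 \<le> p * gain (?e - 1 / p) s + (1 - p) * gain ?e s"
    using key p1 p2 by simp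
qed

text \<open>The numerator is again \<delta> plus the product of both coefficients and
  \<open>s\<close>. The dangerous choice is now skipping, which shrinks the gap; its denominator
  stays positive because \<open>2 s \<le> \<delta> p < 1\<close>.\<close>

lemma gain_lower:
  assumes "0 < p" "p < 1" "0 \<le> s" "2 * s \<le> \<delta> * p" "0 < \<delta>" "\<delta> < 1"
  shows "0 < 1 + (1 / p - (1 - \<delta>)) * s" "0 < 1 + (- (1 - \<delta>)) * s"
    and "0 \<le> p * gain (1 / p - (1 - \<delta>)) s + (1 - p) * gain (- (1 - \<delta>)) s"
proof -
  let ?e = "1 - \<delta>"
  have sp: "s / p \<le> \<delta> / 2" using assms by (simp add: field_simps)
  have ip: "1 < 1 / p" using assms by simp
  then have "0 \<le> (1 / p - ?e) * s" using assms by (intro mult_nonneg_nonneg) linarith+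
  then show p2: "0 < 1 + (1 / p - ?e) * s" by simp
  have "\<delta> * p < 1 * 1" using assms by (intro mult_strict_mono) auto
  then have "s < 1" using assms by simp
  moreover have "?e * s \<le> 1 * s" using assms by (intro mult_right_mono) auto
  ultimately show p1: "0 < 1 + (- ?e) * s" unfolding mult_minus_left by linarith
  have "?e * (s / p) \<le> 1 * (\<delta> / 2)" using sp assms by (intro mult_mono) auto
  moreover have "0 \<le> ?e\<^sup>2 * s" using assms by simp
  ultimately have key: "0 \<le> \<delta> - ?e * (s / p) + ?e\<^sup>2 * s" using assms(5) by linarith
  have "p * gain (1 / p - ?e) s + (1 - p) * gain (- ?e) s
     = (p * (1 / p - ?e) * (1 + (- ?e) * s) + (1 - p) * (- ?e) * (1 + (1 / p - ?e) * s))
       / ((1 + (1 / p - ?e) * s) * (1 + (- ?e) * s))"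
    using p1 p2 by (intro gain_average) auto
  also have "p * (1 / p - ?e) * (1 + (- ?e) * s) + (1 - p) * (- ?e) * (1 + (1 / p - ?e) * s)
     = \<delta> - ?e * (s / p) + ?e\<^sup>2 * s"
    using assms(1) by (simp add: field_simps power2_eq_square)
  finally show "0 \<le> p * gain (1 / p - ?e) s + (1 - p) * gain (- ?e) s"
    using key p1 p2 by simp
qed

text \<open>Keeping the row contributes \<open>1 - cost (1 / p)\<close> to the estimator, skipping
  it \<open>- cost 0\<close>. Averaged with probabilities \<open>p\<close> and \<open>1 - p\<close>
  this is \<open>p\<close> minus a nonnegative expected cost, so the better choice stays below
  \<open>p\<close>, hence below the share of the estimator that the row sets free.\<close>

lemma decision:
  fixes \<delta> s1 s2 q1 q2 :: real
  defines "p \<equiv> min 1 (2 / \<delta> * (s1 + s2))"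
  defines "cost \<equiv> \<lambda>w. 2 / \<delta> * (gain (1 + \<delta> - w) s1 * q1 + gain (w - (1 - \<delta>)) s2 * q2)"
  defines "skip \<equiv> p < 1 \<and> - cost 0 < 1 - cost (1 / p)"
  defines "w \<equiv> if skip then 0 else 1 / p"
  assumes d: "0 < \<delta>" "\<delta> < 1" and s: "0 \<le> s1" "0 \<le> s2" and q: "0 \<le> q1" "0 \<le> q2"
    and z: "s2 = 0 \<Longrightarrow> q2 = 0"
  shows "0 < 1 + (1 + \<delta> - w) * s1" "0 < 1 + (w - (1 - \<delta>)) * s2"
    and "(if skip then 0 else 1) - cost w \<le> 2 / \<delta> * (s1 + s2)"
proof -
  have p0: "0 \<le> p" using d s by (simp add: p_def)
  consider "p = 1" | "p = 0" | "0 < p" "p < 1" using p0 by (fastforce simp: p_def)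
  then have "0 < 1 + (1 + \<delta> - w) * s1 \<and> 0 < 1 + (w - (1 - \<delta>)) * s2 \<and>
    (if skip then 0 else 1) - cost w \<le> 2 / \<delta> * (s1 + s2)"
  proof cases
    case 1
    then have w: "\<not> skip" "w = 1" by (auto simp: skip_def w_def)
    \<comment> \<open>At weight 1 both coefficients equal \<delta>, so neither inverse grows; the
      index itself is paid for by \<open>1 \<le> 2 / \<delta> * (s1 + s2)\<close>.\<close>
    have pos: "0 < 1 + \<delta> * s1" "0 < 1 + \<delta> * s2" using d s by (simp_all add: add_pos_nonneg)
    have "0 \<le> cost 1" using d q pos by (simp add: cost_def gain_def less_imp_le)
    with 1 have "1 - cost 1 \<le> 2 / \<delta> * (s1 + s2)" by (simp add: p_def min_def split: if_splits)
    with w pos show ?thesis by simp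
  next
    case 2
    then have "2 / \<delta> * (s1 + s2) = 0" by (simp add: p_def min_def split: if_splits)
    then have "s1 = 0" "s2 = 0" using d s by auto
    \<comment> \<open>As \<open>1 / 0 = 0\<close>, both options have the same cost, and keeping
      would add an index.\<close>
    moreover from this 2 have skip by (simp add: skip_def)
    \<comment> \<open>The lower coefficient is negative when skipping; this is harmless here because
      \<open>s2 = 0\<close> forces \<open>q2 = 0\<close>.\<close>
    moreover have "0 \<le> cost 0" using d q z \<open>s1 = 0\<close> \<open>s2 = 0\<close> by (simp add: cost_def gain_def)
    ultimately show ?thesis by (simp add: w_def)
  next
    case 3
    then have p: "p = 2 / \<delta> * (s1 + s2)" by (simp add: p_def min_def split: if_splits)
    then have dp: "\<delta> * p = 2 * (s1 + s2)" using d by simp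
    note U = gain_upper[OF 3 s(1) _ d] and L = gain_lower[OF 3 s(2) _ d]
    have b: "2 * s1 \<le> \<delta> * p" "2 * s2 \<le> \<delta> * p" using dp s by auto
    have pos: "0 < 1 + (1 + \<delta> - w) * s1 \<and> 0 < 1 + (w - (1 - \<delta>)) * s2"
      using U(1,2) L(1,2) b by (simp add: w_def)
    have alg: "p * (c * (g1 * q1 + g2 * q2)) + (1 - p) * (c * (h1 * q1 + h2 * q2))
      = c * ((p * g1 + (1 - p) * h1) * q1 + (p * g2 + (1 - p) * h2) * q2)" for c g1 g2 h1 h2
      by (simp add: algebra_simps)
    have "p * cost (1 / p) + (1 - p) * cost 0 =
      2 / \<delta> * ((p * gain (1 + \<delta> - 1 / p) s1 + (1 - p) * gain (1 + \<delta>) s1) * q1 +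
               (p * gain (1 / p - (1 - \<delta>)) s2 + (1 - p) * gain (- (1 - \<delta>)) s2) * q2)"
      unfolding cost_def alg by simp
    also have "\<dots> \<ge> 0"
      by (rule mult_nonneg_nonneg[OF _ add_nonneg_nonneg[OF
            mult_nonneg_nonneg[OF U(3)[OF b(1)] q(1)] mult_nonneg_nonneg[OF L(3)[OF b(2)] q(2)]]])
         (use d in simp)
    finally have avg: "0 \<le> p * cost (1 / p) + (1 - p) * cost 0" .
    \<comment> \<open>The smaller of two numbers is at most their weighted average.\<close>
    have "(if skip then 0 else 1) - cost w \<le> p"
    proof (cases skip)
      case True
      then have "p * (- cost 0) \<le> p * (1 - cost (1 / p))"
        using 3 by (intro mult_left_mono) (auto simp: skip_def)
      with True avg show ?thesis by (simp add: w_def algebra_simps)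
    next
      case False
      then have "(1 - p) * (1 - cost (1 / p)) \<le> (1 - p) * (- cost 0)"
        using 3 by (intro mult_left_mono) (auto simp: skip_def)
      with False avg show ?thesis by (simp add: w_def algebra_simps)
    qed
    with pos p show ?thesis by simp
  qed
  then show "0 < 1 + (1 + \<delta> - w) * s1" "0 < 1 + (w - (1 - \<delta>)) * s2"
    "(if skip then 0 else 1) - cost w \<le> 2 / \<delta> * (s1 + s2)" by blast+
qed

section \<open>Sampling with a pessimistic estimator\<close>

lemma bil_sum_rank_one:
  assumes "\<And>p q. p < n \<Longrightarrow> q < n \<Longrightarrow> R p q = (\<Sum>j\<in>J. c j * a j p * a j q)"
  shows "bil n R u v = (\<Sum>j\<in>J. c j * ip n (a j) u * ip n (a j) v)"
proof -
  have "bil n R u v = (\<Sum>p<n. \<Sum>q<n. \<Sum>j\<in>J. c j * ((a j p * u p) * (a j q * v q)))"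
    unfolding bil_def by (intro sum.cong refl) (simp add: assms sum_distrib_left mult_ac)
  also have "\<dots> = (\<Sum>p<n. \<Sum>j\<in>J. \<Sum>q<n. c j * ((a j p * u p) * (a j q * v q)))"
    by (intro sum.cong refl) (rule sum.swap)
  also have "\<dots> = (\<Sum>j\<in>J. \<Sum>p<n. \<Sum>q<n. c j * ((a j p * u p) * (a j q * v q)))"
    by (rule sum.swap)
  also have "\<dots> = (\<Sum>j\<in>J. c j * (ip n (a j) u * ip n (a j) v))"
    by (simp add: ip_def sum_product sum_distrib_left[symmetric] mult.assoc flip: sum_distrib_left)
  finally show ?thesis by (simp add: mult.assoc)
qed

lemma bil_diagonal:
  assumes "\<And>p q. p < n \<Longrightarrow> q < n \<Longrightarrow> Y p q = (if p = q then c else 0)"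
  shows "bil n Y u v = c * ip n u v"
proof -
  have "bil n Y u v = (\<Sum>p<n. \<Sum>q<n. if p = q then c * (u p * v p) else 0)"
    unfolding bil_def by (intro sum.cong refl) (simp add: assms)
  then show ?thesis by (simp add: ip_def sum_distrib_left)
qed

lemma sum_ip_squares_orthonormal:
  assumes "\<And>p q. p < n \<Longrightarrow> q < n \<Longrightarrow> (\<Sum>j<m. a j p * a j q) = (if p = q then 1 else 0)"
  shows "(\<Sum>j<m. (ip n (a j) v)\<^sup>2) = ip n v v"
  using bil_diagonal[of n "\<lambda>p q. \<Sum>j<m. a j p * a j q" 1 v v]
    bil_sum_rank_one[of n "\<lambda>p q. \<Sum>j<m. a j p * a j q" "\<lambda>j. 1" a "{..<m}" v v] assms
  by (simp add: power2_eq_square)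

text \<open>The trace of \<open>A^T A\<close>, summed by rows and by columns. It determines the
  initial value of the estimator.\<close>

lemma sum_norm_squares_orthonormal:
  assumes "\<And>p q. p < n \<Longrightarrow> q < n \<Longrightarrow> (\<Sum>j<m. a j p * a j q) = (if p = q then 1 else 0)"
  shows "(\<Sum>j<m. ip n (a j) (a j)) = n"
proof -
  have "(\<Sum>j<m. ip n (a j) (a j)) = (\<Sum>p<n. \<Sum>j<m. a j p * a j p)"
    unfolding ip_def by (rule sum.swap)
  with assms show ?thesis by simp
qed

text \<open>For \<open>\<sigma> = 1\<close> this is the distance of the current sample from its upper barrier
  \<open>\<delta> I + (1 + \<delta>) \<Sum>j<i. a j \<otimes> a j\<close>, for \<open>\<sigma> = -1\<close> the distance from its lower barrier
  \<open>-\<delta> I + (1 - \<delta>) \<Sum>j<i. a j \<otimes> a j\<close>.\<close>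

definition barrier_gap ::
  "nat \<Rightarrow> real \<Rightarrow> real \<Rightarrow> (nat \<Rightarrow> nat \<Rightarrow> real) \<Rightarrow> nat \<Rightarrow> nat \<Rightarrow> (nat \<Rightarrow> nat) \<Rightarrow> (nat \<Rightarrow> real) \<Rightarrow>
   (nat \<Rightarrow> real) \<Rightarrow> nat \<Rightarrow> real" where
  "barrier_gap n \<delta> \<sigma> a i t x w v p = \<delta> * v p +
     \<sigma> * ((1 + \<sigma> * \<delta>) * (\<Sum>j<i. ip n (a j) v * a j p) - (\<Sum>l<t. w l * ip n (a (x l)) v * a (x l) p))"

text \<open>Writing at position \<open>t\<close> leaves the earlier positions alone, so the gap
  changes by one rank-one term: the step of the barrier minus the weight. For \<sigma> = 1 and
  \<sigma> = -1 its coefficient is \<open>1 + \<delta> - r\<close> and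
  \<open>r - (1 - \<delta>)\<close>, the arguments of \<open>gain\<close> in
  \<open>decision\<close>.\<close>

lemma barrier_gap_keep:
  assumes "\<sigma> * \<sigma> = 1"
  shows "barrier_gap n \<delta> \<sigma> a (Suc i) (Suc t) (x(t := i)) (w(t := r)) v =
    (\<lambda>p. barrier_gap n \<delta> \<sigma> a i t x w v p + \<sigma> * (1 + \<sigma> * \<delta> - r) * ip n (a i) v * a i p)"
proof -
  have "(\<Sum>l<t. (w(t := r)) l * ip n (a ((x(t := i)) l)) v * a ((x(t := i)) l) p)
      = (\<Sum>l<t. w l * ip n (a (x l)) v * a (x l) p)" for p
    by (intro sum.cong) auto
  then show ?thesis by (auto simp: barrier_gap_def fun_eq_iff algebra_simps)
qed

lemma barrier_gap_skip:
  "barrier_gap n \<delta> \<sigma> a (Suc i) t x w v =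
    (\<lambda>p. barrier_gap n \<delta> \<sigma> a i t x w v p + \<sigma> * (1 + \<sigma> * \<delta>) * ip n (a i) v * a i p)"
  by (auto simp: barrier_gap_def fun_eq_iff algebra_simps)

lemma ip_sum_left: "ip n (\<lambda>p. \<Sum>j\<in>J. c j * a j p) v = (\<Sum>j\<in>J. c j * ip n (a j) v)"
  unfolding ip_def by (simp add: sum_distrib_right sum_distrib_left mult.assoc) (rule sum.swap)

lemma ip_barrier_gap:
  "ip n (barrier_gap n \<delta> \<sigma> a i t x w v) v = \<delta> * ip n v v +
     \<sigma> * ((1 + \<sigma> * \<delta>) * (\<Sum>j<i. (ip n (a j) v)\<^sup>2) - (\<Sum>l<t. w l * (ip n (a (x l)) v)\<^sup>2))"
proof -
  have lin: "ip n (\<lambda>p. \<delta> * v p + \<sigma> * (c * f p - g p)) v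
      = \<delta> * ip n v v + \<sigma> * (c * ip n f v - ip n g v)" for c f g
    by (simp add: ip_def algebra_simps sum.distrib sum_subtractf sum_distrib_left)
  have "ip n (barrier_gap n \<delta> \<sigma> a i t x w v) v = \<delta> * ip n v v +
     \<sigma> * ((1 + \<sigma> * \<delta>) * ip n (\<lambda>p. \<Sum>j<i. ip n (a j) v * a j p) v
       - ip n (\<lambda>p. \<Sum>l<t. w l * ip n (a (x l)) v * a (x l) p) v)"
    unfolding barrier_gap_def[abs_def] by (rule lin)
  then show ?thesis unfolding ip_sum_left by (simp add: power2_eq_square mult.assoc)
qed

text \<open>The last conjunct is the pessimistic estimator: the sum bounds the expected number of
  indices that the random choices behind \<open>decision\<close> would still pick.\<close>

definition sampling_invariant ::
  "nat \<Rightarrow> nat \<Rightarrow> real \<Rightarrow> (nat \<Rightarrow> nat \<Rightarrow> real) \<Rightarrow> nat \<Rightarrow> (nat \<Rightarrow> nat \<Rightarrow> real) \<Rightarrow> (nat \<Rightarrow> nat \<Rightarrow> real) \<Rightarrow>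
   (nat \<Rightarrow> nat \<Rightarrow> real) \<Rightarrow> nat \<Rightarrow> (nat \<Rightarrow> nat) \<Rightarrow> (nat \<Rightarrow> real) \<Rightarrow> bool" where
  "sampling_invariant m n \<delta> a i Y Z R t x w \<longleftrightarrow>
     barrier n Y (barrier_gap n \<delta> 1 a i t x w) \<and>
     barrier n Z (barrier_gap n \<delta> (-1) a i t x w) \<and>
     (\<forall>p<n. \<forall>q<n. R p q = (\<Sum>j\<in>{i..<m}. a j p * a j q)) \<and>
     (\<forall>l<t. x l < m) \<and>
     t + 2 / \<delta> * (\<Sum>j\<in>{i..<m}. bil n Y (a j) (a j) + bil n Z (a j) (a j)) \<le> 4 * n / \<delta>\<^sup>2"

section \<open>Maintaining the sampling invariant\<close>

lemma barrier_diagonal: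
  assumes "0 < \<delta>" and Y: "\<And>p q. p < n \<Longrightarrow> q < n \<Longrightarrow> Y p q = (if p = q then 1 / \<delta> else 0)"
  shows "barrier n Y (barrier_gap n \<delta> \<sigma> a 0 0 x w)"
proof -
  have "ip n v v \<ge> 0" for v by (simp add: ip_def sum_nonneg)
  moreover have "ip n u (\<lambda>p. \<delta> * v p) = \<delta> * ip n u v" for u v
    by (simp add: ip_def sum_distrib_left mult_ac)
  ultimately show ?thesis
    using assms by (auto simp: barrier_def barrier_gap_def[abs_def] bil_diagonal[OF Y])
qed

text \<open>Both gaps start as \<delta> I with inverse \<open>I / \<delta>\<close>, so the estimator
  starts at \<open>2 / \<delta>\<close> times the trace \<open>2 n / \<delta>\<close>. This is the
  source of the bound \<open>4 n / \<delta>\<^sup>2\<close> on the number of indices.\<close>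

lemma sampling_invariant_init:
  assumes d: "0 < \<delta>"
    and Y: "\<And>p q. p < n \<Longrightarrow> q < n \<Longrightarrow> Y p q = (if p = q then 1 / \<delta> else 0)"
    and Z: "\<And>p q. p < n \<Longrightarrow> q < n \<Longrightarrow> Z p q = (if p = q then 1 / \<delta> else 0)"
    and R: "\<And>p q. p < n \<Longrightarrow> q < n \<Longrightarrow> R p q = (if p = q then 1 else 0)"
    and orth: "\<And>p q. p < n \<Longrightarrow> q < n \<Longrightarrow> (\<Sum>j<m. a j p * a j q) = (if p = q then 1 else 0)"
  shows "sampling_invariant m n \<delta> a 0 Y Z R 0 x w"
proof -
  have "(\<Sum>j<m. bil n Y (a j) (a j) + bil n Z (a j) (a j)) = 2 / \<delta> * (\<Sum>j<m. ip n (a j) (a j))"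
    by (simp add: bil_diagonal[OF Y] bil_diagonal[OF Z] sum_distrib_left)
  also have "\<dots> = 2 / \<delta> * n" by (simp add: sum_norm_squares_orthonormal[OF orth])
  finally show ?thesis
    using d by (simp add: sampling_invariant_def barrier_diagonal[OF d Y] barrier_diagonal[OF d Z] R orth
      atLeast0LessThan power2_eq_square)
qed

text \<open>By Sherman-Morrison the sum of \<open>bil n Y (a j) (a j)\<close> over the later rows
  decreases by the gain times the sum of the squares of \<open>bil n Y (a j) (a i)\<close>, and that
  sum is the form of \<open>R'\<close> at \<open>y\<close>. One quadratic form thus replaces a pass
  over all later rows. The hypotheses list the values that the machine computes.\<close>

lemma sampling_invariant_step:
  fixes \<delta> s1 s2 q1 q2 :: real
  assumes inv: "sampling_invariant m n \<delta> a i Y Z R t x w" and "i < m" and d: "0 < \<delta>" "\<delta> < 1"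
    and R': "\<And>p q. p < n \<Longrightarrow> q < n \<Longrightarrow> R' p q = R p q - a i p * a i q"
    and y: "\<And>p. p < n \<Longrightarrow> y p = (\<Sum>q<n. Y p q * a i q)"
    and z: "\<And>p. p < n \<Longrightarrow> z p = (\<Sum>q<n. Z p q * a i q)"
    and s: "s1 = bil n Y (a i) (a i)" "s2 = bil n Z (a i) (a i)"
    and q: "q1 = bil n R' y y" "q2 = bil n R' z z"
    and p: "p = min 1 (2 / \<delta> * (s1 + s2))"
    and cost: "\<And>r. cost r = 2 / \<delta> * (gain (1 + \<delta> - r) s1 * q1 + gain (r - (1 - \<delta>)) s2 * q2)"
    and skip: "skip \<longleftrightarrow> p < 1 \<and> - cost 0 < 1 - cost (1 / p)"
    and r: "r = (if skip then 0 else 1 / p)"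
    and Y': "\<And>p q. p < n \<Longrightarrow> q < n \<Longrightarrow> Y' p q = Y p q - gain (1 + \<delta> - r) s1 * y p * y q"
    and Z': "\<And>p q. p < n \<Longrightarrow> q < n \<Longrightarrow> Z' p q = Z p q - gain (r - (1 - \<delta>)) s2 * z p * z q"
    and t': "t' = (if skip then t else Suc t)" and x': "x' = (if skip then x else x(t := i))"
    and w': "w' = (if skip then w else w(t := r))"
  shows "sampling_invariant m n \<delta> a (Suc i) Y' Z' R' t' x' w'"
proof -
  from inv have barY: "barrier n Y (barrier_gap n \<delta> 1 a i t x w)"
    and barZ: "barrier n Z (barrier_gap n \<delta> (-1) a i t x w)"
    and R: "\<And>p q. p < n \<Longrightarrow> q < n \<Longrightarrow> R p q = (\<Sum>j\<in>{i..<m}. a j p * a j q)"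
    and x: "\<forall>l<t. x l < m"
    and est: "t + 2 / \<delta> * (\<Sum>j\<in>{i..<m}. bil n Y (a j) (a j) + bil n Z (a j) (a j)) \<le> 4 * n / \<delta>\<^sup>2"
    by (auto simp: sampling_invariant_def)
  have split: "(\<Sum>j\<in>{i..<m}. f j) = f i + (\<Sum>j\<in>{Suc i..<m}. f j)" for f :: "nat \<Rightarrow> real"
    using \<open>i < m\<close> by (rule sum.atLeast_Suc_lessThan)
  have R'': "R' p q = (\<Sum>j\<in>{Suc i..<m}. a j p * a j q)" if "p < n" "q < n" for p q
    using that by (simp add: R R' split)
  have bilR': "bil n R' u u = (\<Sum>j\<in>{Suc i..<m}. (ip n (a j) u)\<^sup>2)" for u
    using bil_sum_rank_one[of n R' "\<lambda>j. 1" a "{Suc i..<m}" u u] R'' by (simp add: power2_eq_square)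
  have s0: "0 \<le> s1" "0 \<le> s2" using barY barZ by (auto simp: s barrier_def)
  have q0: "0 \<le> q1" "0 \<le> q2" by (auto simp: q bilR' sum_nonneg)
  have ipz: "ip n u z = bil n Z u (a i)" for u
    unfolding bil_conv_ip by (auto simp: ip_def z)
  \<comment> \<open>If the form of \<open>Z\<close> vanishes at \<open>a i\<close>, then by
    Cauchy-Schwarz every row is orthogonal to \<open>a i\<close> under \<open>Z\<close>.\<close>
  have z0: "q2 = 0" if "s2 = 0"
  proof -
    have "(bil n Z (a j) (a i))\<^sup>2 \<le> bil n Z (a j) (a j) * s2" for j
      unfolding s using barZ by (intro bil_Cauchy_Schwarz) (auto simp: barrier_def)
    with that show ?thesis by (simp add: q bilR' ipz)
  qed
  note dec = decision[OF d s0 q0 z0, folded p, folded cost, folded skip, folded r]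
  have gapY: "barrier_gap n \<delta> 1 a (Suc i) t' x' w' v =
      (\<lambda>p. barrier_gap n \<delta> 1 a i t x w v p + (1 + \<delta> - r) * ip n (a i) v * a i p)" for v
    using barrier_gap_skip[of n \<delta> 1 a i t x w v] barrier_gap_keep[of 1 n \<delta> a i t x w r v]
    by (cases skip) (simp_all add: t' x' w' r)
  have gapZ: "barrier_gap n \<delta> (-1) a (Suc i) t' x' w' v =
      (\<lambda>p. barrier_gap n \<delta> (-1) a i t x w v p + (r - (1 - \<delta>)) * ip n (a i) v * a i p)" for v
    using barrier_gap_skip[of n \<delta> "-1" a i t x w v] barrier_gap_keep[of "-1" n \<delta> a i t x w r v]
    by (cases skip) (simp_all add: t' x' w' r)
  note U = barrier_sherman_morrison[OF barY dec(1)[unfolded s] y Y'[unfolded gain_def s] gapY]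
  note L = barrier_sherman_morrison[OF barZ dec(2)[unfolded s] z Z'[unfolded gain_def s] gapZ]
  have sums: "(\<Sum>j\<in>{Suc i..<m}. bil n Y' (a j) (a j) + bil n Z' (a j) (a j)) =
      (\<Sum>j\<in>{Suc i..<m}. bil n Y (a j) (a j) + bil n Z (a j) (a j))
        - (gain (1 + \<delta> - r) s1 * q1 + gain (r - (1 - \<delta>)) s2 * q2)"
    by (simp add: U(2) L(2) q bilR' gain_def s sum_subtractf sum.distrib sum_distrib_left)
  have "t' + 2 / \<delta> * (\<Sum>j\<in>{Suc i..<m}. bil n Y' (a j) (a j) + bil n Z' (a j) (a j)) =
      t + ((if skip then 0 else 1) - cost r)
        + 2 / \<delta> * (\<Sum>j\<in>{Suc i..<m}. bil n Y (a j) (a j) + bil n Z (a j) (a j))"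
    unfolding sums right_diff_distrib cost by (simp add: t')
  \<comment> \<open>The summand of row \<open>i\<close> leaves the sum and, by
    \<open>decision\<close>, pays for the change that the choice causes.\<close>
  also have "\<dots> \<le> t + 2 / \<delta> * (\<Sum>j\<in>{i..<m}. bil n Y (a j) (a j) + bil n Z (a j) (a j))"
    unfolding split distrib_left[of _ _ "sum _ _"] using dec(3) by (simp add: s)
  also have "\<dots> \<le> 4 * n / \<delta>\<^sup>2" by (rule est)
  finally have "t' + 2 / \<delta> * (\<Sum>j\<in>{Suc i..<m}. bil n Y' (a j) (a j) + bil n Z' (a j) (a j))
    \<le> 4 * n / \<delta>\<^sup>2" .
  moreover have "\<forall>l<t'. x' l < m" using x \<open>i < m\<close> by (auto simp: t' x' less_Suc_eq)
  ultimately show ?thesis using U(1) L(1) R'' by (simp add: sampling_invariant_def)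
qed

section \<open>From the two barriers to the error in norm\<close>

lemma sampling_invariant_final:
  assumes inv: "sampling_invariant m n \<delta> a m Y Z R t x w"
    and orth: "\<And>p q. p < n \<Longrightarrow> q < n \<Longrightarrow> (\<Sum>j<m. a j p * a j q) = (if p = q then 1 else 0)"
  shows "\<bar>(\<Sum>l<t. w l * (ip n (a (x l)) v)\<^sup>2) - ip n v v\<bar> \<le> 2 * \<delta> * ip n v v"
proof -
  \<comment> \<open>After the last row the barriers are \<open>(1 + 2 \<delta>) I\<close> and
    \<open>(1 - 2 \<delta>) I\<close>.\<close>
  have "0 \<le> ip n (barrier_gap n \<delta> 1 a m t x w v) v" "0 \<le> ip n (barrier_gap n \<delta> (-1) a m t x w v) v"
    using inv by (auto simp: sampling_invariant_def intro: barrier_psd)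
  moreover have "(\<Sum>j<m. (ip n (a j) v)\<^sup>2) = ip n v v"
    by (rule sum_ip_squares_orthonormal) (rule orth)
  ultimately show ?thesis
    unfolding ip_barrier_gap by (simp add: algebra_simps abs_le_iff)
qed

text \<open>Polarization: for \<open>u = N v\<close>, the forms at \<open>v + c u\<close> and
  \<open>v - c u\<close> differ by \<open>4 c |u|^2\<close>, while the parallelogram law bounds the
  difference by \<open>2 \<epsilon> (|v|^2 + c^2 |u|^2)\<close>. The choice
  \<open>c = 1 / \<epsilon>\<close> balances the terms.\<close>

lemma quadratic_form_bound:
  assumes sym: "\<And>p q. p < n \<Longrightarrow> q < n \<Longrightarrow> N p q = N q p" and "0 < \<epsilon>"
    and quad: "\<And>v. \<bar>bil n N v v\<bar> \<le> \<epsilon> * ip n v v"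
  shows "ip n (\<lambda>p. \<Sum>q<n. N p q * v q) (\<lambda>p. \<Sum>q<n. N p q * v q) \<le> \<epsilon>\<^sup>2 * ip n v v"
proof -
  define u where "u = (\<lambda>p. \<Sum>q<n. N p q * v q)"
  let ?c = "1 / \<epsilon>"
  have bil: "bil n N u v = ip n u u" "bil n N v u = ip n u u"
    using bil_commute[of n N v u, OF sym] by (simp_all add: bil_conv_ip[of n N u v] flip: u_def)
  have "bil n N (\<lambda>p. v p + ?c * u p) (\<lambda>p. v p + ?c * u p)
      - bil n N (\<lambda>p. v p + (- ?c) * u p) (\<lambda>p. v p + (- ?c) * u p) = 4 * ?c * ip n u u"
    unfolding bil_add_right bil_add_left bil by (simp add: algebra_simps)
  moreover have "ip n (\<lambda>p. v p + c * u p) (\<lambda>p. v p + c * u p)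
      = ip n v v + 2 * c * ip n u v + c\<^sup>2 * ip n u u" for c
    by (simp add: ip_def algebra_simps sum.distrib sum_distrib_left power2_eq_square)
  ultimately have "4 * ?c * ip n u u \<le> \<epsilon> * (ip n v v + 2 * ?c * ip n u v + ?c\<^sup>2 * ip n u u)
      + \<epsilon> * (ip n v v + 2 * (- ?c) * ip n u v + (- ?c)\<^sup>2 * ip n u u)"
    using quad[of "\<lambda>p. v p + ?c * u p"] quad[of "\<lambda>p. v p + (- ?c) * u p"] by (simp only: abs_le_iff) linarith
  then have "ip n u u \<le> \<epsilon>\<^sup>2 * ip n v v"
    using \<open>0 < \<epsilon>\<close> by (simp add: field_simps power2_eq_square)
  then show ?thesis unfolding u_def .
qed

section \<open>Loops on the machine\<close>

definition for_loop :: "string \<Rightarrow> string \<Rightarrow> program \<Rightarrow> program" where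
  "for_loop x y c =
     Seq (AssignN x (NLit 0) (NLit 0))
       (Loop (BLessN (NCell x (NLit 0)) (NCell y (NLit 0)))
         (Seq c (AssignN x (NLit 0) (NAdd (NCell x (NLit 0)) (NLit 1)))))"

lemma runs_cost: "runs c s T s' \<Longrightarrow> T = U \<Longrightarrow> s' = u \<Longrightarrow> runs c s U u"
  by simp

text \<open>\<open>I k\<close> describes the memory right after the counter has been set to
  \<open>k\<close>. Besides the body, a pass costs 6 for the guard and 6 for the increment;
  initialization and the last, failing test add 3 and 6.\<close>

lemma for_loop_runs:
  assumes start: "I 0 (write_nat x 0 0 s)"
    and guard: "\<And>k s. I k s \<Longrightarrow> nat_mem s x 0 = k \<and> nat_mem s y 0 = N"
    and step: "\<And>k s. k < N \<Longrightarrow> I k s \<Longrightarrow>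
      \<exists>T s'. runs c s T s' \<and> T \<le> b \<and> nat_mem s' x 0 = k \<and> I (Suc k) (write_nat x 0 (Suc k) s')"
  shows "\<exists>T s'. runs (for_loop x y c) s T s' \<and> T \<le> N * (b + 12) + 9 \<and> I N s'"
proof -
  let ?d = "Seq c (AssignN x (NLit 0) (NAdd (NCell x (NLit 0)) (NLit 1)))"
  let ?b = "BLessN (NCell x (NLit 0)) (NCell y (NLit 0))"
  have loop: "\<exists>T s'. runs (Loop ?b ?d) s T s' \<and> T \<le> j * (b + 12) + 6 \<and> I N s'"
    if "I k s" "j + k = N" for j k s
    using that
  proof (induction j arbitrary: k s)
    case 0
    then have "\<not> bval s ?b" using guard[OF 0(1)] by simp
    from runs.LoopFalse[OF this, of ?d] 0 show ?case by fastforce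
  next
    case (Suc j)
    have b: "bval s ?b" using guard[OF Suc(2)] Suc(3) by simp
    from Suc(3) have "k < N" by simp
    from step[OF this Suc(2)] obtain T s' where c: "runs c s T s'" "T \<le> b"
      "nat_mem s' x 0 = k" "I (Suc k) (write_nat x 0 (Suc k) s')" by blast
    have assign: "runs (AssignN x (NLit 0) (NAdd (NCell x (NLit 0)) (NLit 1))) s' 6
        (write_nat x 0 (Suc k) s')"
      by (rule runs_cost[OF runs.AssignN]) (simp_all add: c(3))
    have d: "runs ?d s (T + 6) (write_nat x 0 (Suc k) s')"
      by (rule runs_cost[OF runs.Seq[OF c(1) assign]]) (simp_all add: c(3))
    from Suc.IH[OF c(4)] Suc(3) obtain T' s'' where
      r: "runs (Loop ?b ?d) (write_nat x 0 (Suc k) s') T' s''" "T' \<le> j * (b + 12) + 6" "I N s''"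
      by auto
    from runs.LoopTrue[OF b d r(1)] c(2) r(2,3) show ?case by fastforce
  qed
  from loop[OF start, of N] obtain T s' where
    r: "runs (Loop ?b ?d) (write_nat x 0 0 s) T s'" "T \<le> N * (b + 12) + 6" "I N s'" by auto
  have assign: "runs (AssignN x (NLit 0) (NLit 0)) s 3 (write_nat x 0 0 s)"
    by (rule runs_cost[OF runs.AssignN]) simp_all
  have "runs (for_loop x y c) s (3 + T) s'"
    unfolding for_loop_def by (rule runs.Seq[OF assign r(1)])
  with r show ?thesis by fastforce
qed

section \<open>Adding to an array in nested loops\<close>

fun arrays_read :: "rexp \<Rightarrow> string set" where
  "arrays_read (RLit k) = {}"
| "arrays_read (RNat a) = {}"
| "arrays_read (RCell x a b) = {x}"
| "arrays_read (RAdd a b) = arrays_read a \<union> arrays_read b"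
| "arrays_read (RSub a b) = arrays_read a \<union> arrays_read b"
| "arrays_read (RMul a b) = arrays_read a \<union> arrays_read b"
| "arrays_read (RDiv a b) = arrays_read a \<union> arrays_read b"

definition add_to :: "string \<Rightarrow> (nat \<Rightarrow> nat \<Rightarrow> real) \<Rightarrow> memory \<Rightarrow> memory" where
  "add_to X F s = s\<lparr>real_mem := (real_mem s)(X := (\<lambda>i j. real_mem s X i j + F i j))\<rparr>"

lemma nat_mem_add_to [simp]: "nat_mem (add_to X F s) = nat_mem s"
  by (simp add: add_to_def)

lemma real_mem_add_to: "X \<noteq> Y \<Longrightarrow> real_mem (add_to X F s) Y = real_mem s Y"
  by (simp add: add_to_def)

lemma nval_add_to [simp]: "nval (add_to X F s) a = nval s a"
  by (induction a) auto

text \<open>Keeps the value of the summand fixed while the sums are being built up. Index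
  expressions contain no reals, so the names of the real arrays decide.\<close>

lemma rval_add_to: "X \<notin> arrays_read e \<Longrightarrow> rval (add_to X F s) e = rval s e"
  by (induction e) (auto simp: real_mem_add_to)

lemma write_nat_add_to: "write_nat x i k (add_to X F s) = add_to X F (write_nat x i k s)"
  by (simp add: write_nat_def add_to_def)

lemma add_to_add_to: "add_to X F (add_to X G s) = add_to X (\<lambda>i j. G i j + F i j) s"
  by (simp add: add_to_def add.assoc)

lemma add_to_zero: "add_to X (\<lambda>i j. 0) s = s"
  by (simp add: add_to_def)

text \<open>Incrementing one cell adds a point mass, so a loop of increments composes to a single
  \<open>add_to\<close> of a sum.\<close>

lemma write_real_add_to:
  "write_real X a b (real_mem s X a b + r) s = add_to X (\<lambda>i j. if a = i \<and> b = j then r else 0) s"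
  by (auto simp: write_real_def add_to_def fun_eq_iff)

lemma nat_mem_write_nat:
  "nat_mem (write_nat x i k s) = (nat_mem s)(x := (nat_mem s x)(i := k))"
  by (simp add: write_nat_def)

lemma real_mem_write_nat [simp]: "real_mem (write_nat x i k s) = real_mem s"
  by (simp add: write_nat_def)

lemma write_nat_same [simp]: "write_nat x i k (write_nat x i l s) = write_nat x i k s"
  by (simp add: write_nat_def)

lemma write_nat_swap: "x \<noteq> y \<Longrightarrow> write_nat x i k (write_nat y j l s) = write_nat y j l (write_nat x i k s)"
  by (simp add: write_nat_def fun_upd_twist)

text \<open>One loop shape serves all the linear algebra: target cell \<open>(p, q)\<close> gives an
  entrywise update, \<open>(i, p)\<close> a matrix-vector product, \<open>(i, 0)\<close> a quadratic
  form.\<close>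

definition accumulate :: "string \<Rightarrow> nexp \<Rightarrow> nexp \<Rightarrow> rexp \<Rightarrow> program" where
  "accumulate X a b e =
     for_loop ''p'' ''n'' (for_loop ''q'' ''n'' (AssignR X a b (RAdd (RCell X a b) e)))"

definition at_entry :: "memory \<Rightarrow> nat \<Rightarrow> nat \<Rightarrow> memory" where
  "at_entry s p q = write_nat ''q'' 0 q (write_nat ''p'' 0 p s)"

lemma accumulate_row:
  assumes X: "X \<notin> arrays_read e" and n: "nat_mem s ''n'' 0 = n"
  shows "\<exists>T s'. runs (for_loop ''q'' ''n'' (AssignR X a b (RAdd (RCell X a b) e))) s T s' \<and>
    T \<le> n * (3 + 2 * ncost a + 2 * ncost b + rcost e + 12) + 9 \<and>
    s' = add_to X (\<lambda>i j. \<Sum>q<n. if nval (write_nat ''q'' 0 q s) a = i \<and> nval (write_nat ''q'' 0 q s) b = j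
                                  then rval (write_nat ''q'' 0 q s) e else 0) (write_nat ''q'' 0 n s)"
\<comment> \<open>Unification reads the invariant off the goal: the description of \<open>s'\<close>
  with the counter in place of \<open>n\<close>.\<close>
proof (rule for_loop_runs, goal_cases)
  case (1)
  show ?case by (simp add: add_to_zero)
next
  case (2 k s)
  with n show ?case by (auto simp: nat_mem_write_nat)
next
  case (3 k s')
  let ?s = "write_nat ''q'' 0 k s"
  have 1: "runs (AssignR X a b (RAdd (RCell X a b) e)) s' (3 + 2 * ncost a + 2 * ncost b + rcost e)
     (write_real X (nval s' a) (nval s' b) (real_mem s' X (nval s' a) (nval s' b) + rval s' e) s')"
    by (rule runs_cost[OF runs.AssignR]) simp_all
  show ?case
    by (rule exI conjI 1)+
      (auto simp: 3(2) rval_add_to[OF X] write_real_add_to add_to_add_to write_nat_add_to nat_mem_write_nat)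
qed

lemma accumulate_runs:
  assumes X: "X \<notin> arrays_read e" and n: "nat_mem s ''n'' 0 = n"
  shows "\<exists>T s'. runs (accumulate X a b e) s T s' \<and>
    T \<le> n * (n * (15 + 2 * ncost a + 2 * ncost b + rcost e) + 21) + 9 \<and>
    (\<forall>v. v \<noteq> ''p'' \<longrightarrow> v \<noteq> ''q'' \<longrightarrow> nat_mem s' v = nat_mem s v) \<and>
    real_mem s' = (real_mem s)(X := (\<lambda>i j. real_mem s X i j +
      (\<Sum>p<n. \<Sum>q<n. if nval (at_entry s p q) a = i \<and> nval (at_entry s p q) b = j
                     then rval (at_entry s p q) e else 0)))"
proof -
  let ?F = "\<lambda>k i j. \<Sum>p<k. \<Sum>q<n. if nval (at_entry s p q) a = i \<and> nval (at_entry s p q) b = j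
                     then rval (at_entry s p q) e else 0"
  let ?B = "n * (3 + 2 * ncost a + 2 * ncost b + rcost e + 12) + 9"
  have "\<exists>T s'. runs (accumulate X a b e) s T s' \<and> T \<le> n * (?B + 12) + 9 \<and>
    (\<exists>c. s' = add_to X (?F n) (write_nat ''q'' 0 c (write_nat ''p'' 0 n s)))"
    unfolding accumulate_def
  \<comment> \<open>The value of the inner counter is left open: before the first pass it is the old
    one, afterwards \<open>n\<close>.\<close>
  proof (rule for_loop_runs[where I =
      "\<lambda>k s'. \<exists>c. s' = add_to X (?F k) (write_nat ''q'' 0 c (write_nat ''p'' 0 k s))"], goal_cases)
    case 1
    have "write_nat ''p'' 0 0 s = write_nat ''q'' 0 (nat_mem s ''q'' 0) (write_nat ''p'' 0 0 s)"
      by (simp add: write_nat_def fun_upd_idem)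
    then show ?case by (auto simp: add_to_zero)
  next
    case (2 k s')
    with n show ?case by (auto simp: nat_mem_write_nat)
  next
    case (3 k s')
    then obtain c where c: "s' = add_to X (?F k) (write_nat ''q'' 0 c (write_nat ''p'' 0 k s))" by blast
    then have n': "nat_mem s' ''n'' 0 = n" using n by (simp add: nat_mem_write_nat)
    have w: "write_nat ''q'' 0 q s' = add_to X (?F k) (at_entry s k q)" for q
      by (simp add: c write_nat_add_to at_entry_def)
    from accumulate_row[OF X n', of a b] obtain T s'' where
      r: "runs (for_loop ''q'' ''n'' (AssignR X a b (RAdd (RCell X a b) e))) s' T s''" "T \<le> ?B" and
      s'': "s'' = add_to X (\<lambda>i j. \<Sum>q<n. if nval (at_entry s k q) a = i \<and> nval (at_entry s k q) b = j
                                  then rval (at_entry s k q) e else 0) (write_nat ''q'' 0 n s')"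
      unfolding w nval_add_to rval_add_to[OF X] by blast
    have s2: "s'' = add_to X (?F (Suc k)) (at_entry s k n)"
      unfolding s'' w add_to_add_to by simp
    show ?case
      by (rule exI conjI r)+
        (auto simp: s2 write_nat_add_to at_entry_def write_nat_swap[of "''p''" "''q''"] nat_mem_write_nat)
  qed
  then obtain T s' c where r: "runs (accumulate X a b e) s T s'" "T \<le> n * (?B + 12) + 9"
    and s': "s' = add_to X (?F n) (write_nat ''q'' 0 c (write_nat ''p'' 0 n s))" by blast
  from r(2) have "T \<le> n * (n * (15 + 2 * ncost a + 2 * ncost b + rcost e) + 21) + 9"
    by (simp add: algebra_simps)
  moreover have "\<forall>v. v \<noteq> ''p'' \<longrightarrow> v \<noteq> ''q'' \<longrightarrow> nat_mem s' v = nat_mem s v"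
    by (simp add: s' nat_mem_write_nat)
  moreover have "real_mem s' = (real_mem s)(X := (\<lambda>i j. real_mem s X i j + ?F n i j))"
    by (simp add: s' add_to_def)
  ultimately show ?thesis using r(1) by blast
qed

lemma real_mem_at_entry [simp]: "real_mem (at_entry s p q) = real_mem s"
  by (simp add: at_entry_def)

lemma nat_mem_at_entry:
  "nat_mem (at_entry s p q) ''p'' 0 = p" "nat_mem (at_entry s p q) ''q'' 0 = q"
  "v \<noteq> ''p'' \<Longrightarrow> v \<noteq> ''q'' \<Longrightarrow> nat_mem (at_entry s p q) v = nat_mem s v"
  by (simp_all add: at_entry_def nat_mem_write_nat)

section \<open>Entrywise updates, matrix-vector products and quadratic forms\<close>

abbreviation (input) scalar :: "string \<Rightarrow> nexp" where "scalar x \<equiv> NCell x (NLit 0)"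

text \<open>\<open>200 = 15 + 155 + 21 + 9\<close>, the lower-order terms being bounded by multiples
  of \<open>n\<^sup>2\<close>. The 155 leaves 147 for the summand, as two target indices of cost at
  most 2 are each counted twice.\<close>

lemma accumulate_cost:
  fixes n :: nat
  assumes "T \<le> n * (n * (15 + c) + 21) + 9" "c \<le> 155" "1 \<le> n"
  shows "T \<le> 200 * n\<^sup>2"
proof -
  have "n \<le> n * n" by simp
  moreover have "1 \<le> n * n" using assms(3) by simp
  moreover have "n * (n * (15 + c)) \<le> n * (n * 170)"
    using assms(2) by (intro mult_le_mono order_refl) simp
  moreover have "n * (n * (15 + c) + 21) = n * (n * (15 + c)) + 21 * n"
    by (simp add: algebra_simps)
  ultimately show ?thesis using assms(1) unfolding power2_eq_square by linarith
qed

text \<open>Each cell of the block is hit by one pair of counters, so the double sum collapses.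
  \<open>N\<close> records the natural memory apart from the counters, so that successive
  accumulations chain whatever values the counters were left with.\<close>

lemma accumulate_entries:
  assumes N: "\<And>v. v \<noteq> ''p'' \<Longrightarrow> v \<noteq> ''q'' \<Longrightarrow> nat_mem s v = N v"
    and n: "N ''n'' 0 = n" "1 \<le> n"
    and X: "X \<notin> arrays_read e" and cost: "rcost e \<le> 147"
    and E: "\<And>p q. p < n \<Longrightarrow> q < n \<Longrightarrow> rval (at_entry s p q) e = E p q"
  shows "\<exists>T s'. runs (accumulate X (scalar ''p'') (scalar ''q'') e) s T s' \<and> T \<le> 200 * n\<^sup>2 \<and>
    (\<forall>v. v \<noteq> ''p'' \<longrightarrow> v \<noteq> ''q'' \<longrightarrow> nat_mem s' v = N v) \<and>
    real_mem s' = (real_mem s)(X := (\<lambda>i j. real_mem s X i j +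
       (if i < n \<and> j < n then E i j else 0)))"
proof -
  have F: "(\<Sum>p<n. \<Sum>q<n. if p = i \<and> q = j then rval (at_entry s p q) e else 0)
      = (if i < n \<and> j < n then E i j else 0)" for i j
  proof -
    have "(\<Sum>p<n. \<Sum>q<n. if p = i \<and> q = j then rval (at_entry s p q) e else 0)
      = (\<Sum>p<n. if p = i then (\<Sum>q<n. if q = j then rval (at_entry s p q) e else 0) else 0)"
      by (intro sum.cong) auto
    then show ?thesis by (simp add: E)
  qed
  have n': "nat_mem s ''n'' 0 = n" using n by (simp add: N)
  have ix: "nval (at_entry s p q) (scalar ''p'') = p" "nval (at_entry s p q) (scalar ''q'') = q" for p q
    by (simp_all add: nat_mem_at_entry N)
  obtain T s' where r: "runs (accumulate X (scalar ''p'') (scalar ''q'') e) s T s'"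
    "T \<le> n * (n * (15 + (2 * ncost (scalar ''p'') + (2 * ncost (scalar ''q'') + rcost e))) + 21) + 9"
    "\<forall>v. v \<noteq> ''p'' \<longrightarrow> v \<noteq> ''q'' \<longrightarrow> nat_mem s' v = nat_mem s v"
    "real_mem s' = (real_mem s)(X := (\<lambda>i j. real_mem s X i j +
       (\<Sum>p<n. \<Sum>q<n. if p = i \<and> q = j then rval (at_entry s p q) e else 0)))"
    using accumulate_runs[OF X n', of "scalar ''p''" "scalar ''q''"] unfolding ix add.assoc by blast
  have "T \<le> 200 * n\<^sup>2"
    by (rule accumulate_cost[OF r(2) _ n(2)]) (use cost in simp)
  moreover have "\<forall>v. v \<noteq> ''p'' \<longrightarrow> v \<noteq> ''q'' \<longrightarrow> nat_mem s' v = N v"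
    using r(3) by (simp add: N)
  ultimately show ?thesis
    using r(1) r(4)[unfolded F] by (intro exI[of _ T] exI[of _ s'] conjI)
qed

text \<open>Only the outer counter selects the cell, so the inner sum survives: a matrix-vector
  product, stored in row \<open>k\<close>.\<close>

lemma accumulate_row_sums:
  assumes N: "\<And>v. v \<noteq> ''p'' \<Longrightarrow> v \<noteq> ''q'' \<Longrightarrow> nat_mem s v = N v"
    and n: "N ''n'' 0 = n" "1 \<le> n" and k: "N ''i'' 0 = k"
    and X: "X \<notin> arrays_read e" and cost: "rcost e \<le> 147"
    and E: "\<And>p q. p < n \<Longrightarrow> q < n \<Longrightarrow> rval (at_entry s p q) e = E p q"
  shows "\<exists>T s'. runs (accumulate X (scalar ''i'') (scalar ''p'') e) s T s' \<and> T \<le> 200 * n\<^sup>2 \<and>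
    (\<forall>v. v \<noteq> ''p'' \<longrightarrow> v \<noteq> ''q'' \<longrightarrow> nat_mem s' v = N v) \<and>
    real_mem s' = (real_mem s)(X := (\<lambda>i j. real_mem s X i j +
       (if i = k \<and> j < n then \<Sum>q<n. E j q else 0)))"
proof -
  have F: "(\<Sum>p<n. \<Sum>q<n. if k = i \<and> p = j then rval (at_entry s p q) e else 0)
      = (if i = k \<and> j < n then \<Sum>q<n. E j q else 0)" for i j
  proof -
    have "(\<Sum>p<n. \<Sum>q<n. if k = i \<and> p = j then rval (at_entry s p q) e else 0)
      = (\<Sum>p<n. if p = j then (\<Sum>q<n. if k = i then rval (at_entry s p q) e else 0) else 0)"
      by (intro sum.cong) auto
    then show ?thesis by (simp add: E)
  qed
  have n': "nat_mem s ''n'' 0 = n" using n by (simp add: N)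
  have ix: "nval (at_entry s p q) (scalar ''i'') = k" "nval (at_entry s p q) (scalar ''p'') = p" for p q
    by (simp_all add: nat_mem_at_entry N k)
  obtain T s' where r: "runs (accumulate X (scalar ''i'') (scalar ''p'') e) s T s'"
    "T \<le> n * (n * (15 + (2 * ncost (scalar ''i'') + (2 * ncost (scalar ''p'') + rcost e))) + 21) + 9"
    "\<forall>v. v \<noteq> ''p'' \<longrightarrow> v \<noteq> ''q'' \<longrightarrow> nat_mem s' v = nat_mem s v"
    "real_mem s' = (real_mem s)(X := (\<lambda>i j. real_mem s X i j +
       (\<Sum>p<n. \<Sum>q<n. if k = i \<and> p = j then rval (at_entry s p q) e else 0)))"
    using accumulate_runs[OF X n', of "scalar ''i''" "scalar ''p''"] unfolding ix add.assoc by blast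
  have "T \<le> 200 * n\<^sup>2"
    by (rule accumulate_cost[OF r(2) _ n(2)]) (use cost in simp)
  moreover have "\<forall>v. v \<noteq> ''p'' \<longrightarrow> v \<noteq> ''q'' \<longrightarrow> nat_mem s' v = N v"
    using r(3) by (simp add: N)
  ultimately show ?thesis
    using r(1) r(4)[unfolded F] by (intro exI[of _ T] exI[of _ s'] conjI)
qed

text \<open>Every pass hits the cell \<open>(k, 0)\<close>, where the whole quadratic form
  collects.\<close>

lemma accumulate_double_sum:
  assumes N: "\<And>v. v \<noteq> ''p'' \<Longrightarrow> v \<noteq> ''q'' \<Longrightarrow> nat_mem s v = N v"
    and n: "N ''n'' 0 = n" "1 \<le> n" and k: "N ''i'' 0 = k"
    and X: "X \<notin> arrays_read e" and cost: "rcost e \<le> 147"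
    and E: "\<And>p q. p < n \<Longrightarrow> q < n \<Longrightarrow> rval (at_entry s p q) e = E p q"
  shows "\<exists>T s'. runs (accumulate X (scalar ''i'') (NLit 0) e) s T s' \<and> T \<le> 200 * n\<^sup>2 \<and>
    (\<forall>v. v \<noteq> ''p'' \<longrightarrow> v \<noteq> ''q'' \<longrightarrow> nat_mem s' v = N v) \<and>
    real_mem s' = (real_mem s)(X := (\<lambda>i j. real_mem s X i j +
       (if i = k \<and> j = 0 then \<Sum>p<n. \<Sum>q<n. E p q else 0)))"
proof -
  have F: "(\<Sum>p<n. \<Sum>q<n. if k = i \<and> 0 = j then rval (at_entry s p q) e else 0)
      = (if i = k \<and> j = 0 then \<Sum>p<n. \<Sum>q<n. E p q else 0)" for i j
    by (auto simp: E intro!: sum.cong)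
  have n': "nat_mem s ''n'' 0 = n" using n by (simp add: N)
  have ix: "nval (at_entry s p q) (scalar ''i'') = k" "nval (at_entry s p q) (NLit 0) = 0" for p q
    by (simp_all add: nat_mem_at_entry N k)
  obtain T s' where r: "runs (accumulate X (scalar ''i'') (NLit 0) e) s T s'"
    "T \<le> n * (n * (15 + (2 * ncost (scalar ''i'') + (2 * ncost (NLit 0) + rcost e))) + 21) + 9"
    "\<forall>v. v \<noteq> ''p'' \<longrightarrow> v \<noteq> ''q'' \<longrightarrow> nat_mem s' v = nat_mem s v"
    "real_mem s' = (real_mem s)(X := (\<lambda>i j. real_mem s X i j +
       (\<Sum>p<n. \<Sum>q<n. if k = i \<and> 0 = j then rval (at_entry s p q) e else 0)))"
    using accumulate_runs[OF X n', of "scalar ''i''" "NLit 0"] unfolding ix add.assoc by blast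
  have "T \<le> 200 * n\<^sup>2"
    by (rule accumulate_cost[OF r(2) _ n(2)]) (use cost in simp)
  moreover have "\<forall>v. v \<noteq> ''p'' \<longrightarrow> v \<noteq> ''q'' \<longrightarrow> nat_mem s' v = N v"
    using r(3) by (simp add: N)
  ultimately show ?thesis
    using r(1) r(4)[unfolded F] by (intro exI[of _ T] exI[of _ s'] conjI)
qed

section \<open>The program\<close>

abbreviation (input) entry :: "string \<Rightarrow> rexp" where
  "entry X \<equiv> RCell X (scalar ''p'') (scalar ''q'')"

abbreviation (input) row_at :: "string \<Rightarrow> string \<Rightarrow> rexp" where
  "row_at X p \<equiv> RCell X (scalar ''i'') (scalar p)"

abbreviation (input) row_scalar :: "string \<Rightarrow> rexp" where
  "row_scalar X \<equiv> RCell X (scalar ''i'') (NLit 0)"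

abbreviation (input) real_scalar :: "string \<Rightarrow> rexp" where
  "real_scalar X \<equiv> RCell X (NLit 0) (NLit 0)"

definition half_eps :: rexp where
  "half_eps = RDiv (real_scalar ''eps'') (RLit 2)"

definition gain_exp :: "rexp \<Rightarrow> rexp \<Rightarrow> rexp" where
  "gain_exp g s = RDiv g (RAdd (RLit 1) (RMul g s))"

definition upper_gain :: "rexp \<Rightarrow> rexp" where
  "upper_gain w = gain_exp (RSub (RAdd (RLit 1) half_eps) w) (row_scalar ''c'')"

definition lower_gain :: "rexp \<Rightarrow> rexp" where
  "lower_gain w = gain_exp (RSub w (RSub (RLit 1) half_eps)) (row_scalar ''d'')"

definition cost_exp :: "rexp \<Rightarrow> rexp" where
  "cost_exp w = RMul (RDiv (RLit 2) half_eps)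
     (RAdd (RMul (upper_gain w) (row_scalar ''f'')) (RMul (lower_gain w) (row_scalar ''g'')))"

definition skip_exp :: bexp where
  "skip_exp = BAnd (BLessR (real_scalar ''h'') (RLit 1))
     (BLessR (RSub (RLit 0) (cost_exp (RLit 0)))
       (RSub (RLit 1) (cost_exp (RDiv (RLit 1) (real_scalar ''h'')))))"

text \<open>The machine has no minimum, so \<open>h\<close> is computed first and then clipped at 1.
  The weight stays in \<open>w\<close> for the later updates of both inverses, also when the row is
  skipped.\<close>

definition decide :: program where
  "decide =
     Seq (AssignR ''h'' (NLit 0) (NLit 0)
           (RMul (RDiv (RLit 2) half_eps) (RAdd (row_scalar ''c'') (row_scalar ''d''))))
    (Seq (Cond (BLessR (RLit 1) (real_scalar ''h'')) (AssignR ''h'' (NLit 0) (NLit 0) (RLit 1)) Skip)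
         (Cond skip_exp
            (AssignR ''w'' (NLit 0) (NLit 0) (RLit 0))
            (Seq (AssignR ''w'' (NLit 0) (NLit 0) (RDiv (RLit 1) (real_scalar ''h'')))
            (Seq (AssignN ''x'' (scalar ''t'') (scalar ''i''))
            (Seq (AssignR ''s'' (scalar ''t'') (NLit 0) (real_scalar ''w''))
                 (AssignN ''t'' (NLit 0) (NAdd (scalar ''t'') (NLit 1))))))))"

lemma real_mem_write_real:
  "real_mem (write_real x i j r s) = (real_mem s)(x := (real_mem s x)(i := (real_mem s x i)(j := r)))"
  by (simp add: write_real_def)

lemma nat_mem_write_real [simp]: "nat_mem (write_real x i j r s) = nat_mem s"
  by (simp add: write_real_def)

lemmas exp_defs = half_eps_def gain_exp_def upper_gain_def lower_gain_def cost_exp_def skip_exp_def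

text \<open>Division on the machine is that of the logic, with \<open>1 / 0 = 0\<close>, so the code
  follows \<open>decision\<close> literally even for \<open>p = 0\<close>.\<close>

lemma decide_runs:
  fixes s :: memory and c d f g \<delta> p r :: real
  assumes i: "nat_mem s ''i'' 0 = i" and \<delta>: "real_mem s ''eps'' 0 0 / 2 = \<delta>"
    and vals: "real_mem s ''c'' i 0 = c" "real_mem s ''d'' i 0 = d"
      "real_mem s ''f'' i 0 = f" "real_mem s ''g'' i 0 = g"
    and old: "nat_mem s ''t'' 0 = t" "nat_mem s ''x'' = x" "(\<lambda>l. real_mem s ''s'' l 0) = w"
    and p: "p = min 1 (2 / \<delta> * (c + d))"
    and cost: "\<And>r. cost r = 2 / \<delta> * (gain (1 + \<delta> - r) c * f + gain (r - (1 - \<delta>)) d * g)"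
    and skip: "skip \<longleftrightarrow> p < 1 \<and> - cost 0 < 1 - cost (1 / p)"
    and r: "r = (if skip then 0 else 1 / p)"
  obtains T s' where "runs decide s T s'" "T \<le> 500"
    "real_mem s' ''w'' 0 0 = r"
    "\<And>X. X \<noteq> ''h'' \<Longrightarrow> X \<noteq> ''w'' \<Longrightarrow> X \<noteq> ''s'' \<Longrightarrow> real_mem s' X = real_mem s X"
    "\<And>v. v \<noteq> ''t'' \<Longrightarrow> v \<noteq> ''x'' \<Longrightarrow> nat_mem s' v = nat_mem s v"
    "nat_mem s' ''t'' 0 = (if skip then t else Suc t)"
    "nat_mem s' ''x'' = (if skip then x else x(t := i))"
    "(\<lambda>l. real_mem s' ''s'' l 0) = (if skip then w else w(t := r))"
proof -
  let ?h = "2 / \<delta> * (c + d)"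
  define s1 where "s1 = write_real ''h'' 0 0 ?h s"
  define s2 where "s2 = (if 1 < ?h then write_real ''h'' 0 0 1 s1 else s1)"
  have r1: "runs (AssignR ''h'' (NLit 0) (NLit 0)
           (RMul (RDiv (RLit 2) half_eps) (RAdd (row_scalar ''c'') (row_scalar ''d'')))) s 20 s1"
    by (rule runs_cost[OF runs.AssignR]) (simp_all add: half_eps_def s1_def i \<delta> vals)
  have h1: "real_mem s1 ''h'' 0 0 = ?h" by (simp add: s1_def real_mem_write_real)
  have "\<exists>T \<le> 10. runs (Cond (BLessR (RLit 1) (real_scalar ''h''))
      (AssignR ''h'' (NLit 0) (NLit 0) (RLit 1)) Skip) s1 T s2"
  proof (cases "1 < ?h")
    case True
    have a: "runs (AssignR ''h'' (NLit 0) (NLit 0) (RLit 1)) s1 4 s2"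
      by (rule runs_cost[OF runs.AssignR]) (use True in \<open>simp_all add: s2_def\<close>)
    have "bval s1 (BLessR (RLit 1) (real_scalar ''h''))" using True h1 by simp
    show ?thesis by (rule exI, rule conjI[rotated], rule runs.CondTrue[OF \<open>bval s1 _\<close> a]) simp
  next
    case False
    have a: "runs Skip s1 1 s2" using False runs.Skip by (simp add: s2_def)
    have "\<not> bval s1 (BLessR (RLit 1) (real_scalar ''h''))" using False h1 by simp
    show ?thesis by (rule exI, rule conjI[rotated], rule runs.CondFalse[OF \<open>\<not> bval s1 _\<close> a]) simp
  qed
  then obtain T2 where r2: "T2 \<le> 10" "runs (Cond (BLessR (RLit 1) (real_scalar ''h''))
      (AssignR ''h'' (NLit 0) (NLit 0) (RLit 1)) Skip) s1 T2 s2" by blast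
  have nat2: "nat_mem s2 = nat_mem s" by (simp add: s2_def s1_def)
  have real2: "real_mem s2 X = real_mem s X" if "X \<noteq> ''h''" for X
    using that by (simp add: s2_def s1_def real_mem_write_real)
  have h2: "real_mem s2 ''h'' 0 0 = p" using p h1 by (auto simp: s2_def real_mem_write_real min_def)
  have gains: "rval s2 (upper_gain e) = gain (1 + \<delta> - rval s2 e) c"
    "rval s2 (lower_gain e) = gain (rval s2 e - (1 - \<delta>)) d" for e
    by (simp_all add: exp_defs gain_def real2 nat2 i \<delta> vals)
  have costs: "rval s2 (cost_exp e) = cost (rval s2 e)" for e
    by (simp add: cost_exp_def gains cost half_eps_def real2 nat2 i \<delta> vals)
  have skip': "bval s2 skip_exp \<longleftrightarrow> skip"
    by (simp add: skip_exp_def costs h2 skip)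
  have bc: "bcost skip_exp \<le> 300" by (simp add: exp_defs)
  show thesis
  proof (cases skip)
    case True
    let ?s = "write_real ''w'' 0 0 0 s2"
    have a: "runs (AssignR ''w'' (NLit 0) (NLit 0) (RLit 0)) s2 4 ?s"
      by (rule runs_cost[OF runs.AssignR]) simp_all
    from True skip' have "bval s2 skip_exp" by simp
    then have R: "runs decide s (20 + (T2 + (1 + bcost skip_exp + 4))) ?s"
      unfolding decide_def by (intro runs.Seq[OF r1] runs.Seq[OF r2(2)] runs.CondTrue a)
    show thesis
      by (rule that[OF R]) (use True r r2(1) bc in
        \<open>simp_all add: real_mem_write_real nat2 real2 old\<close>)
  next
    case False
    let ?s3 = "write_real ''w'' 0 0 r s2"
    let ?s4 = "write_nat ''x'' t i ?s3"
    let ?s5 = "write_real ''s'' t 0 r ?s4"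
    let ?s6 = "write_nat ''t'' 0 (Suc t) ?s5"
    have a: "runs (AssignR ''w'' (NLit 0) (NLit 0) (RDiv (RLit 1) (real_scalar ''h''))) s2 8 ?s3"
      by (rule runs_cost[OF runs.AssignR]) (use False in \<open>simp_all add: h2 r\<close>)
    have b: "runs (AssignN ''x'' (scalar ''t'') (scalar ''i'')) ?s3 5 ?s4"
      by (rule runs_cost[OF runs.AssignN]) (simp_all add: nat2 i old)
    have c: "runs (AssignR ''s'' (scalar ''t'') (NLit 0) (real_scalar ''w'')) ?s4 7 ?s5"
      by (rule runs_cost[OF runs.AssignR]) (simp_all add: nat2 nat_mem_write_nat real_mem_write_real old)
    have d: "runs (AssignN ''t'' (NLit 0) (NAdd (scalar ''t'') (NLit 1))) ?s5 6 ?s6"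
      by (rule runs_cost[OF runs.AssignN]) (simp_all add: nat2 nat_mem_write_nat old)
    from False skip' have "\<not> bval s2 skip_exp" by simp
    then have R: "runs decide s (20 + (T2 + (1 + bcost skip_exp + (8 + (5 + (7 + 6)))))) ?s6"
      unfolding decide_def
      by (intro runs.Seq[OF r1] runs.Seq[OF r2(2)] runs.CondFalse runs.Seq[OF a] runs.Seq[OF b] runs.Seq[OF c] d)
    show thesis
      by (rule that[OF R]) (use False r2(1) bc in
        \<open>simp_all add: real_mem_write_real nat_mem_write_nat nat2 real2 old fun_eq_iff flip: old(3)\<close>)
  qed
qed

text \<open>Row \<open>i\<close> of the arrays \<open>y\<close>, \<open>z\<close> holds \<open>Y a\<^sub>i\<close>, \<open>Z a\<^sub>i\<close>; the cells \<open>c\<close>, \<open>d\<close>, \<open>f\<close>, \<open>g\<close>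
  of that row hold \<open>s1\<close>, \<open>s2\<close>, \<open>q1\<close>, \<open>q2\<close> of lemma \<open>decision\<close>, \<open>h\<close> its probability \<open>p\<close>. Using a
  fresh row in every iteration replaces resetting the accumulators, as memory is initially zero.\<close>

definition process_row :: program where
  "process_row =
     Seq (accumulate ''R'' (scalar ''p'') (scalar ''q'')
           (RSub (RLit 0) (RMul (row_at ''A'' ''p'') (row_at ''A'' ''q''))))
    (Seq (accumulate ''y'' (scalar ''i'') (scalar ''p'') (RMul (entry ''Y'') (row_at ''A'' ''q'')))
    (Seq (accumulate ''z'' (scalar ''i'') (scalar ''p'') (RMul (entry ''Z'') (row_at ''A'' ''q'')))
    (Seq (accumulate ''c'' (scalar ''i'') (NLit 0)
           (RMul (RMul (entry ''Y'') (row_at ''A'' ''p'')) (row_at ''A'' ''q'')))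
    (Seq (accumulate ''d'' (scalar ''i'') (NLit 0)
           (RMul (RMul (entry ''Z'') (row_at ''A'' ''p'')) (row_at ''A'' ''q'')))
    (Seq (accumulate ''f'' (scalar ''i'') (NLit 0)
           (RMul (RMul (entry ''R'') (row_at ''y'' ''p'')) (row_at ''y'' ''q'')))
    (Seq (accumulate ''g'' (scalar ''i'') (NLit 0)
           (RMul (RMul (entry ''R'') (row_at ''z'' ''p'')) (row_at ''z'' ''q'')))
    (Seq decide
    (Seq (accumulate ''Y'' (scalar ''p'') (scalar ''q'') (RSub (RLit 0)
           (RMul (RMul (upper_gain (real_scalar ''w'')) (row_at ''y'' ''p'')) (row_at ''y'' ''q''))))
         (accumulate ''Z'' (scalar ''p'') (scalar ''q'') (RSub (RLit 0)
           (RMul (RMul (lower_gain (real_scalar ''w'')) (row_at ''z'' ''p'')) (row_at ''z'' ''q''))))))))))))"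

section \<open>One iteration of the outer loop\<close>

definition loop_invariant :: "nat \<Rightarrow> nat \<Rightarrow> real \<Rightarrow> (nat \<Rightarrow> nat \<Rightarrow> real) \<Rightarrow> nat \<Rightarrow> memory \<Rightarrow> bool" where
  "loop_invariant m n \<epsilon> a i s \<longleftrightarrow>
     nat_mem s ''m'' 0 = m \<and> nat_mem s ''n'' 0 = n \<and> nat_mem s ''i'' 0 = i \<and>
     real_mem s ''A'' = a \<and> real_mem s ''eps'' 0 0 = \<epsilon> \<and>
     (\<forall>X \<in> {''y'', ''z'', ''c'', ''d'', ''f'', ''g''}. \<forall>j\<ge>i. \<forall>l. real_mem s X j l = 0) \<and>
     sampling_invariant m n (\<epsilon> / 2) a i (real_mem s ''Y'') (real_mem s ''Z'') (real_mem s ''R'')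
       (nat_mem s ''t'' 0) (nat_mem s ''x'') (\<lambda>l. real_mem s ''s'' l 0)"

text \<open>The order of the updates matters: \<open>R\<close> loses row \<open>i\<close> first, so
  that \<open>q1\<close> and \<open>q2\<close> see only later rows, while \<open>Y\<close> and
  \<open>Z\<close> change last, after everything has been computed from the old inverses.\<close>

lemma process_row_runs:
  assumes inv: "loop_invariant m n \<epsilon> a i s" and "i < m" and n: "1 \<le> n" and \<epsilon>: "0 < \<epsilon>" "\<epsilon> < 1"
  shows "\<exists>T s'. runs process_row s T s' \<and> T \<le> 2300 * n\<^sup>2 \<and> nat_mem s' ''i'' 0 = i \<and>
    loop_invariant m n \<epsilon> a (Suc i) (write_nat ''i'' 0 (Suc i) s')"
proof -
  define \<delta> where "\<delta> = \<epsilon> / 2"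
  have \<delta>: "0 < \<delta>" "\<delta> < 1" using \<epsilon> by (simp_all add: \<delta>_def)
  define Y Z R where "Y = real_mem s ''Y''" and "Z = real_mem s ''Z''" and "R = real_mem s ''R''"
  define t x w where "t = nat_mem s ''t'' 0" and "x = nat_mem s ''x''" and "w = (\<lambda>l. real_mem s ''s'' l 0)"
  from inv have nats: "nat_mem s ''m'' 0 = m" "nat_mem s ''n'' 0 = n" "nat_mem s ''i'' 0 = i"
    and a: "real_mem s ''A'' = a" and eps: "real_mem s ''eps'' 0 0 = \<epsilon>"
    and zero: "\<And>j l. i \<le> j \<Longrightarrow> real_mem s ''y'' j l = 0" "\<And>j l. i \<le> j \<Longrightarrow> real_mem s ''z'' j l = 0"
      "\<And>j l. i \<le> j \<Longrightarrow> real_mem s ''c'' j l = 0" "\<And>j l. i \<le> j \<Longrightarrow> real_mem s ''d'' j l = 0"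
      "\<And>j l. i \<le> j \<Longrightarrow> real_mem s ''f'' j l = 0" "\<And>j l. i \<le> j \<Longrightarrow> real_mem s ''g'' j l = 0"
    and samp: "sampling_invariant m n \<delta> a i Y Z R t x w"
    by (auto simp: loop_invariant_def Y_def Z_def R_def t_def x_def w_def \<delta>_def)
  \<comment> \<open>Outside the \<open>n \<times> n\<close> block these functions keep the old
    contents, so that they equal the arrays in memory as functions.\<close>
  define R' where "R' = (\<lambda>p q. R p q + (if p < n \<and> q < n then - (a i p * a i q) else 0))"
  define y where "y = (\<lambda>p. if p < n then \<Sum>q<n. Y p q * a i q else 0)"
  define z where "z = (\<lambda>p. if p < n then \<Sum>q<n. Z p q * a i q else 0)"
  define s1 s2 where "s1 = bil n Y (a i) (a i)" and "s2 = bil n Z (a i) (a i)"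
  define q1 q2 where "q1 = bil n R' y y" and "q2 = bil n R' z z"
  define p where "p = min 1 (2 / \<delta> * (s1 + s2))"
  define cost where "cost = (\<lambda>r. 2 / \<delta> * (gain (1 + \<delta> - r) s1 * q1 + gain (r - (1 - \<delta>)) s2 * q2))"
  define skip where "skip \<longleftrightarrow> p < 1 \<and> - cost 0 < 1 - cost (1 / p)"
  define r where "r = (if skip then 0 else 1 / p)"
  define Y' where "Y' = (\<lambda>k l. Y k l + (if k < n \<and> l < n then - (gain (1 + \<delta> - r) s1 * y k * y l) else 0))"
  define Z' where "Z' = (\<lambda>k l. Z k l + (if k < n \<and> l < n then - (gain (r - (1 - \<delta>)) s2 * z k * z l) else 0))"
  note simps = nat_mem_at_entry nats a eps n[simplified]
  have "\<exists>T s'. runs (accumulate ''R'' (scalar ''p'') (scalar ''q'') (RSub (RLit 0) (RMul (row_at ''A'' ''p'') (row_at ''A'' ''q'')))) s T s' \<and> T \<le> 200 * n\<^sup>2 \<and>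
      (\<forall>v. v \<noteq> ''p'' \<longrightarrow> v \<noteq> ''q'' \<longrightarrow> nat_mem s' v = nat_mem s v) \<and>
      real_mem s' = (real_mem s)(''R'' := (\<lambda>j l. real_mem s ''R'' j l + (if j < n \<and> l < n then - (a i j * a i l) else 0)))"
    by (rule accumulate_entries[where E = "\<lambda>p q. - (a i p * a i q)"]) (simp_all add: simps)
  then obtain T1 u1 where r1: "runs (accumulate ''R'' (scalar ''p'') (scalar ''q'') (RSub (RLit 0) (RMul (row_at ''A'' ''p'') (row_at ''A'' ''q'')))) s T1 u1" "T1 \<le> 200 * n\<^sup>2"
    and n1: "\<And>v. v \<noteq> ''p'' \<Longrightarrow> v \<noteq> ''q'' \<Longrightarrow> nat_mem u1 v = nat_mem s v"
    and m1: "real_mem u1 = (real_mem s)(''R'' := (\<lambda>j l. real_mem s ''R'' j l + (if j < n \<and> l < n then - (a i j * a i l) else 0)))"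
    by blast
  have m1: "real_mem u1 = (real_mem s)(''R'' := R')" unfolding m1 by (simp add: R'_def R_def)
  have "\<exists>T s'. runs (accumulate ''y'' (scalar ''i'') (scalar ''p'') (RMul (entry ''Y'') (row_at ''A'' ''q''))) u1 T s' \<and> T \<le> 200 * n\<^sup>2 \<and>
      (\<forall>v. v \<noteq> ''p'' \<longrightarrow> v \<noteq> ''q'' \<longrightarrow> nat_mem s' v = nat_mem s v) \<and>
      real_mem s' = (real_mem u1)(''y'' := (\<lambda>j l. real_mem u1 ''y'' j l + (if j = i \<and> l < n then \<Sum>q<n. Y l q * a i q else 0)))"
    by (rule accumulate_row_sums[where E = "\<lambda>p q. Y p q * a i q"]) (simp_all add: simps n1 m1 Y_def)
  then obtain T2 u2 where r2: "runs (accumulate ''y'' (scalar ''i'') (scalar ''p'') (RMul (entry ''Y'') (row_at ''A'' ''q''))) u1 T2 u2" "T2 \<le> 200 * n\<^sup>2"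
    and n2: "\<And>v. v \<noteq> ''p'' \<Longrightarrow> v \<noteq> ''q'' \<Longrightarrow> nat_mem u2 v = nat_mem s v"
    and m2: "real_mem u2 = (real_mem u1)(''y'' := (\<lambda>j l. real_mem u1 ''y'' j l + (if j = i \<and> l < n then \<Sum>q<n. Y l q * a i q else 0)))"
    by blast
  \<comment> \<open>The array is named as a whole: its earlier rows hold old data, and only row
    \<open>i\<close> and the zero rows after it matter.\<close>
  define Fy where "Fy = real_mem u2 ''y''"
  have Fy: "Fy i = y" "\<And>j l. Suc i \<le> j \<Longrightarrow> Fy j l = 0" by (auto simp: Fy_def m2 m1 zero y_def)
  have m2: "real_mem u2 = (real_mem s)(''R'' := R', ''y'' := Fy)" by (simp add: Fy_def m2 m1)
  have "\<exists>T s'. runs (accumulate ''z'' (scalar ''i'') (scalar ''p'') (RMul (entry ''Z'') (row_at ''A'' ''q''))) u2 T s' \<and> T \<le> 200 * n\<^sup>2 \<and>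
      (\<forall>v. v \<noteq> ''p'' \<longrightarrow> v \<noteq> ''q'' \<longrightarrow> nat_mem s' v = nat_mem s v) \<and>
      real_mem s' = (real_mem u2)(''z'' := (\<lambda>j l. real_mem u2 ''z'' j l + (if j = i \<and> l < n then \<Sum>q<n. Z l q * a i q else 0)))"
    by (rule accumulate_row_sums[where E = "\<lambda>p q. Z p q * a i q"]) (simp_all add: simps n2 m2 Z_def)
  then obtain T3 u3 where r3: "runs (accumulate ''z'' (scalar ''i'') (scalar ''p'') (RMul (entry ''Z'') (row_at ''A'' ''q''))) u2 T3 u3" "T3 \<le> 200 * n\<^sup>2"
    and n3: "\<And>v. v \<noteq> ''p'' \<Longrightarrow> v \<noteq> ''q'' \<Longrightarrow> nat_mem u3 v = nat_mem s v"
    and m3: "real_mem u3 = (real_mem u2)(''z'' := (\<lambda>j l. real_mem u2 ''z'' j l + (if j = i \<and> l < n then \<Sum>q<n. Z l q * a i q else 0)))"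
    by blast
  define Fz where "Fz = real_mem u3 ''z''"
  have Fz: "Fz i = z" "\<And>j l. Suc i \<le> j \<Longrightarrow> Fz j l = 0" by (auto simp: Fz_def m3 m2 zero z_def)
  have m3: "real_mem u3 = (real_mem s)(''R'' := R', ''y'' := Fy, ''z'' := Fz)" by (simp add: Fz_def m3 m2)
  have "\<exists>T s'. runs (accumulate ''c'' (scalar ''i'') (NLit 0) (RMul (RMul (entry ''Y'') (row_at ''A'' ''p'')) (row_at ''A'' ''q''))) u3 T s' \<and> T \<le> 200 * n\<^sup>2 \<and>
      (\<forall>v. v \<noteq> ''p'' \<longrightarrow> v \<noteq> ''q'' \<longrightarrow> nat_mem s' v = nat_mem s v) \<and>
      real_mem s' = (real_mem u3)(''c'' := (\<lambda>j l. real_mem u3 ''c'' j l + (if j = i \<and> l = 0 then \<Sum>p<n. \<Sum>q<n. Y p q * a i p * a i q else 0)))"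
    by (rule accumulate_double_sum[where E = "\<lambda>p q. Y p q * a i p * a i q"]) (simp_all add: simps n3 m3 Y_def)
  then obtain T4 u4 where r4: "runs (accumulate ''c'' (scalar ''i'') (NLit 0) (RMul (RMul (entry ''Y'') (row_at ''A'' ''p'')) (row_at ''A'' ''q''))) u3 T4 u4" "T4 \<le> 200 * n\<^sup>2"
    and n4: "\<And>v. v \<noteq> ''p'' \<Longrightarrow> v \<noteq> ''q'' \<Longrightarrow> nat_mem u4 v = nat_mem s v"
    and m4: "real_mem u4 = (real_mem u3)(''c'' := (\<lambda>j l. real_mem u3 ''c'' j l + (if j = i \<and> l = 0 then \<Sum>p<n. \<Sum>q<n. Y p q * a i p * a i q else 0)))"
    by blast
  define Fc where "Fc = real_mem u4 ''c''"
  have Fc: "Fc i 0 = s1" "\<And>j l. Suc i \<le> j \<Longrightarrow> Fc j l = 0" by (auto simp: Fc_def m4 m3 zero s1_def bil_def)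
  have m4: "real_mem u4 = (real_mem s)(''R'' := R', ''y'' := Fy, ''z'' := Fz, ''c'' := Fc)" by (simp add: Fc_def m4 m3)
  have "\<exists>T s'. runs (accumulate ''d'' (scalar ''i'') (NLit 0) (RMul (RMul (entry ''Z'') (row_at ''A'' ''p'')) (row_at ''A'' ''q''))) u4 T s' \<and> T \<le> 200 * n\<^sup>2 \<and>
      (\<forall>v. v \<noteq> ''p'' \<longrightarrow> v \<noteq> ''q'' \<longrightarrow> nat_mem s' v = nat_mem s v) \<and>
      real_mem s' = (real_mem u4)(''d'' := (\<lambda>j l. real_mem u4 ''d'' j l + (if j = i \<and> l = 0 then \<Sum>p<n. \<Sum>q<n. Z p q * a i p * a i q else 0)))"
    by (rule accumulate_double_sum[where E = "\<lambda>p q. Z p q * a i p * a i q"]) (simp_all add: simps n4 m4 Z_def)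
  then obtain T5 u5 where r5: "runs (accumulate ''d'' (scalar ''i'') (NLit 0) (RMul (RMul (entry ''Z'') (row_at ''A'' ''p'')) (row_at ''A'' ''q''))) u4 T5 u5" "T5 \<le> 200 * n\<^sup>2"
    and n5: "\<And>v. v \<noteq> ''p'' \<Longrightarrow> v \<noteq> ''q'' \<Longrightarrow> nat_mem u5 v = nat_mem s v"
    and m5: "real_mem u5 = (real_mem u4)(''d'' := (\<lambda>j l. real_mem u4 ''d'' j l + (if j = i \<and> l = 0 then \<Sum>p<n. \<Sum>q<n. Z p q * a i p * a i q else 0)))"
    by blast
  define Fd where "Fd = real_mem u5 ''d''"
  have Fd: "Fd i 0 = s2" "\<And>j l. Suc i \<le> j \<Longrightarrow> Fd j l = 0" by (auto simp: Fd_def m5 m4 zero s2_def bil_def)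
  have m5: "real_mem u5 = (real_mem s)(''R'' := R', ''y'' := Fy, ''z'' := Fz, ''c'' := Fc, ''d'' := Fd)" by (simp add: Fd_def m5 m4)
  have "\<exists>T s'. runs (accumulate ''f'' (scalar ''i'') (NLit 0) (RMul (RMul (entry ''R'') (row_at ''y'' ''p'')) (row_at ''y'' ''q''))) u5 T s' \<and> T \<le> 200 * n\<^sup>2 \<and>
      (\<forall>v. v \<noteq> ''p'' \<longrightarrow> v \<noteq> ''q'' \<longrightarrow> nat_mem s' v = nat_mem s v) \<and>
      real_mem s' = (real_mem u5)(''f'' := (\<lambda>j l. real_mem u5 ''f'' j l + (if j = i \<and> l = 0 then \<Sum>p<n. \<Sum>q<n. R' p q * y p * y q else 0)))"
    by (rule accumulate_double_sum[where E = "\<lambda>p q. R' p q * y p * y q"]) (simp_all add: simps n5 m5 Fy)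
  then obtain T6 u6 where r6: "runs (accumulate ''f'' (scalar ''i'') (NLit 0) (RMul (RMul (entry ''R'') (row_at ''y'' ''p'')) (row_at ''y'' ''q''))) u5 T6 u6" "T6 \<le> 200 * n\<^sup>2"
    and n6: "\<And>v. v \<noteq> ''p'' \<Longrightarrow> v \<noteq> ''q'' \<Longrightarrow> nat_mem u6 v = nat_mem s v"
    and m6: "real_mem u6 = (real_mem u5)(''f'' := (\<lambda>j l. real_mem u5 ''f'' j l + (if j = i \<and> l = 0 then \<Sum>p<n. \<Sum>q<n. R' p q * y p * y q else 0)))"
    by blast
  define Ff where "Ff = real_mem u6 ''f''"
  have Ff: "Ff i 0 = q1" "\<And>j l. Suc i \<le> j \<Longrightarrow> Ff j l = 0" by (auto simp: Ff_def m6 m5 zero q1_def bil_def)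
  have m6: "real_mem u6 = (real_mem s)(''R'' := R', ''y'' := Fy, ''z'' := Fz, ''c'' := Fc, ''d'' := Fd, ''f'' := Ff)" by (simp add: Ff_def m6 m5)
  have "\<exists>T s'. runs (accumulate ''g'' (scalar ''i'') (NLit 0) (RMul (RMul (entry ''R'') (row_at ''z'' ''p'')) (row_at ''z'' ''q''))) u6 T s' \<and> T \<le> 200 * n\<^sup>2 \<and>
      (\<forall>v. v \<noteq> ''p'' \<longrightarrow> v \<noteq> ''q'' \<longrightarrow> nat_mem s' v = nat_mem s v) \<and>
      real_mem s' = (real_mem u6)(''g'' := (\<lambda>j l. real_mem u6 ''g'' j l + (if j = i \<and> l = 0 then \<Sum>p<n. \<Sum>q<n. R' p q * z p * z q else 0)))"
    by (rule accumulate_double_sum[where E = "\<lambda>p q. R' p q * z p * z q"]) (simp_all add: simps n6 m6 Fz)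
  then obtain T7 u7 where r7: "runs (accumulate ''g'' (scalar ''i'') (NLit 0) (RMul (RMul (entry ''R'') (row_at ''z'' ''p'')) (row_at ''z'' ''q''))) u6 T7 u7" "T7 \<le> 200 * n\<^sup>2"
    and n7: "\<And>v. v \<noteq> ''p'' \<Longrightarrow> v \<noteq> ''q'' \<Longrightarrow> nat_mem u7 v = nat_mem s v"
    and m7: "real_mem u7 = (real_mem u6)(''g'' := (\<lambda>j l. real_mem u6 ''g'' j l + (if j = i \<and> l = 0 then \<Sum>p<n. \<Sum>q<n. R' p q * z p * z q else 0)))"
    by blast
  define Fg where "Fg = real_mem u7 ''g''"
  have Fg: "Fg i 0 = q2" "\<And>j l. Suc i \<le> j \<Longrightarrow> Fg j l = 0" by (auto simp: Fg_def m7 m6 zero q2_def bil_def)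
  have m7: "real_mem u7 = (real_mem s)(''R'' := R', ''y'' := Fy, ''z'' := Fz, ''c'' := Fc, ''d'' := Fd, ''f'' := Ff, ''g'' := Fg)" by (simp add: Fg_def m7 m6)
  obtain T8 u8 where r8: "runs decide u7 T8 u8" "T8 \<le> 500"
    and w8: "real_mem u8 ''w'' 0 0 = r"
    and m8: "\<And>X. X \<noteq> ''h'' \<Longrightarrow> X \<noteq> ''w'' \<Longrightarrow> X \<noteq> ''s'' \<Longrightarrow> real_mem u8 X = real_mem u7 X"
    and n8: "\<And>v. v \<noteq> ''t'' \<Longrightarrow> v \<noteq> ''x'' \<Longrightarrow> nat_mem u8 v = nat_mem u7 v"
    and out: "nat_mem u8 ''t'' 0 = (if skip then t else Suc t)"
      "nat_mem u8 ''x'' = (if skip then x else x(t := i))"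
      "(\<lambda>l. real_mem u8 ''s'' l 0) = (if skip then w else w(t := r))"
  proof (rule decide_runs[of u7 i \<delta> s1 s2 q1 q2 t x w p cost skip r])
    fix T s'
    assume "runs decide u7 T s'" "T \<le> 500" "real_mem s' ''w'' 0 0 = r"
      "\<And>X. X \<noteq> ''h'' \<Longrightarrow> X \<noteq> ''w'' \<Longrightarrow> X \<noteq> ''s'' \<Longrightarrow> real_mem s' X = real_mem u7 X"
      "\<And>v. v \<noteq> ''t'' \<Longrightarrow> v \<noteq> ''x'' \<Longrightarrow> nat_mem s' v = nat_mem u7 v"
      "nat_mem s' ''t'' 0 = (if skip then t else Suc t)"
      "nat_mem s' ''x'' = (if skip then x else x(t := i))"
      "(\<lambda>l. real_mem s' ''s'' l 0) = (if skip then w else w(t := r))"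
    then show thesis by (rule that)
  qed (simp_all add: n7 m7 nats eps \<delta>_def[symmetric] Fc Fd Ff Fg p_def cost_def skip_def r_def t_def x_def w_def)
  have nats8: "nat_mem u8 ''n'' 0 = n" "nat_mem u8 ''i'' 0 = i" "nat_mem u8 ''m'' 0 = m"
    by (simp_all add: n8 n7 nats)
  have "\<exists>T s'. runs (accumulate ''Y'' (scalar ''p'') (scalar ''q'') (RSub (RLit 0) (RMul (RMul (upper_gain (real_scalar ''w'')) (row_at ''y'' ''p'')) (row_at ''y'' ''q'')))) u8 T s' \<and> T \<le> 200 * n\<^sup>2 \<and>
      (\<forall>v. v \<noteq> ''p'' \<longrightarrow> v \<noteq> ''q'' \<longrightarrow> nat_mem s' v = nat_mem u8 v) \<and>
      real_mem s' = (real_mem u8)(''Y'' := (\<lambda>j l. real_mem u8 ''Y'' j l + (if j < n \<and> l < n then - (gain (1 + \<delta> - r) s1 * y j * y l) else 0)))"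
    by (rule accumulate_entries[where E = "\<lambda>p q. - (gain (1 + \<delta> - r) s1 * y p * y q)"]) (simp_all add: simps nats8 w8 m8 m7 Fy Fc upper_gain_def gain_exp_def half_eps_def gain_def \<delta>_def)
  then obtain T9 u9 where r9: "runs (accumulate ''Y'' (scalar ''p'') (scalar ''q'') (RSub (RLit 0) (RMul (RMul (upper_gain (real_scalar ''w'')) (row_at ''y'' ''p'')) (row_at ''y'' ''q'')))) u8 T9 u9" "T9 \<le> 200 * n\<^sup>2"
    and n9: "\<And>v. v \<noteq> ''p'' \<Longrightarrow> v \<noteq> ''q'' \<Longrightarrow> nat_mem u9 v = nat_mem u8 v"
    and m9: "real_mem u9 = (real_mem u8)(''Y'' := (\<lambda>j l. real_mem u8 ''Y'' j l + (if j < n \<and> l < n then - (gain (1 + \<delta> - r) s1 * y j * y l) else 0)))"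
    by blast
  have m9: "real_mem u9 = (real_mem u8)(''Y'' := Y')" by (simp add: m9 m8 m7 Y'_def Y_def)
  have "\<exists>T s'. runs (accumulate ''Z'' (scalar ''p'') (scalar ''q'') (RSub (RLit 0) (RMul (RMul (lower_gain (real_scalar ''w'')) (row_at ''z'' ''p'')) (row_at ''z'' ''q'')))) u9 T s' \<and> T \<le> 200 * n\<^sup>2 \<and>
      (\<forall>v. v \<noteq> ''p'' \<longrightarrow> v \<noteq> ''q'' \<longrightarrow> nat_mem s' v = nat_mem u8 v) \<and>
      real_mem s' = (real_mem u9)(''Z'' := (\<lambda>j l. real_mem u9 ''Z'' j l + (if j < n \<and> l < n then - (gain (r - (1 - \<delta>)) s2 * z j * z l) else 0)))"
    by (rule accumulate_entries[where E = "\<lambda>p q. - (gain (r - (1 - \<delta>)) s2 * z p * z q)"]) (simp_all add: simps n9 nats8 w8 m9 m8 m7 Fz Fd lower_gain_def gain_exp_def half_eps_def gain_def \<delta>_def)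
  then obtain T10 u10 where r10: "runs (accumulate ''Z'' (scalar ''p'') (scalar ''q'') (RSub (RLit 0) (RMul (RMul (lower_gain (real_scalar ''w'')) (row_at ''z'' ''p'')) (row_at ''z'' ''q'')))) u9 T10 u10" "T10 \<le> 200 * n\<^sup>2"
    and n10: "\<And>v. v \<noteq> ''p'' \<Longrightarrow> v \<noteq> ''q'' \<Longrightarrow> nat_mem u10 v = nat_mem u8 v"
    and m10: "real_mem u10 = (real_mem u9)(''Z'' := (\<lambda>j l. real_mem u9 ''Z'' j l + (if j < n \<and> l < n then - (gain (r - (1 - \<delta>)) s2 * z j * z l) else 0)))"
    by blast
  have m10: "real_mem u10 = (real_mem u8)(''Y'' := Y', ''Z'' := Z')" by (simp add: m10 m9 m8 m7 Z'_def Z_def)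
  have run: "runs process_row s
      (T1 + (T2 + (T3 + (T4 + (T5 + (T6 + (T7 + (T8 + (T9 + T10))))))))) u10"
    unfolding process_row_def
    by (intro runs.Seq) (rule r1(1) r2(1) r3(1) r4(1) r5(1) r6(1) r7(1) r8(1) r9(1) r10(1))+
  have "1 * 1 \<le> n * n" using n by (intro mult_le_mono) simp_all
  then have "1 \<le> n\<^sup>2" by (simp add: power2_eq_square)
  \<comment> \<open>Nine accumulations at 200 and at most 500 for \<open>decide\<close>.\<close>
  then have bound: "T1 + (T2 + (T3 + (T4 + (T5 + (T6 + (T7 + (T8 + (T9 + T10)))))))) \<le> 2300 * n\<^sup>2"
    using r1(2) r2(2) r3(2) r4(2) r5(2) r6(2) r7(2) r8(2) r9(2) r10(2) by linarith
  have "sampling_invariant m n \<delta> a (Suc i) Y' Z' R' (nat_mem u8 ''t'' 0) (nat_mem u8 ''x'')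
      (\<lambda>l. real_mem u8 ''s'' l 0)"
    by (rule sampling_invariant_step[OF samp \<open>i < m\<close> \<delta>, where y = y and z = z, OF _ _ _ s1_def s2_def
          q1_def q2_def p_def _ _ r_def _ _ out, of cost])
      (simp_all add: R'_def y_def z_def cost_def skip_def Y'_def Z'_def)
  then have "loop_invariant m n \<epsilon> a (Suc i) (write_nat ''i'' 0 (Suc i) u10)"
    by (auto simp: loop_invariant_def nat_mem_write_nat n10 nats8 m10 m8 m7 a eps Fy Fz Fc Fd Ff Fg \<delta>_def)
  moreover have "nat_mem u10 ''i'' 0 = i" by (simp add: n10 nats8)
  ultimately show ?thesis using run bound by blast
qed

section \<open>The whole program\<close>

definition kronecker_exp :: rexp where
  "kronecker_exp = RNat (NSub (NLit 1) (NAdd (NSub (scalar ''p'') (scalar ''q'')) (NSub (scalar ''q'') (scalar ''p''))))"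

text \<open>Since \<open>A^T A = I\<close>, the sum over all rows with which \<open>R\<close> must
  start is the identity and need not be computed.\<close>

definition sparsify :: program where
  "sparsify =
     Seq (accumulate ''R'' (scalar ''p'') (scalar ''q'') kronecker_exp)
    (Seq (accumulate ''Y'' (scalar ''p'') (scalar ''q'') (RDiv kronecker_exp half_eps))
    (Seq (accumulate ''Z'' (scalar ''p'') (scalar ''q'') (RDiv kronecker_exp half_eps))
         (for_loop ''i'' ''m'' process_row)))"

text \<open>With truncated subtraction, \<open>(p - q) + (q - p)\<close> is the distance of
  \<open>p\<close> and \<open>q\<close>, and 1 minus it is nonzero only on the diagonal.\<close>

lemma rval_kronecker_exp: "rval (at_entry s p q) kronecker_exp = (if p = q then 1 else 0)"
  by (auto simp: kronecker_exp_def nat_mem_at_entry)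

lemma sparsify_runs:
  fixes A :: "real mat"
  assumes n: "1 \<le> n" "n \<le> m" and \<epsilon>: "0 < \<epsilon>" "\<epsilon> < 1"
    and a: "a = (\<lambda>j p. if j < m \<and> p < n then A $$ (j, p) else 0)"
    and orth: "\<And>p q. p < n \<Longrightarrow> q < n \<Longrightarrow> (\<Sum>j<m. a j p * a j q) = (if p = q then 1 else 0)"
  shows "\<exists>T out. runs sparsify (input_memory m n A \<epsilon>) T out \<and> T \<le> 3000 * (m * n\<^sup>2) \<and>
    loop_invariant m n \<epsilon> a m out"
proof -
  define s where "s = input_memory m n A \<epsilon>"
  have nats: "nat_mem s = (\<lambda>x i. if x = ''m'' \<and> i = 0 then m else if x = ''n'' \<and> i = 0 then n else 0)"
    and A: "real_mem s ''A'' = a" and eps: "real_mem s ''eps'' 0 0 = \<epsilon>"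
    and zero: "\<And>X. X \<noteq> ''A'' \<Longrightarrow> X \<noteq> ''eps'' \<Longrightarrow> real_mem s X = (\<lambda>i j. 0)"
    by (auto simp: s_def input_memory_def a fun_eq_iff)
  define D where "D = (\<lambda>c k l. if k < n \<and> l < n then (if k = l then c else 0) else (0::real))"
  note simps = rval_kronecker_exp half_eps_def nats eps n[simplified]
  have "\<exists>T s'. runs (accumulate ''R'' (scalar ''p'') (scalar ''q'') kronecker_exp) s T s' \<and> T \<le> 200 * n\<^sup>2 \<and>
      (\<forall>v. v \<noteq> ''p'' \<longrightarrow> v \<noteq> ''q'' \<longrightarrow> nat_mem s' v = nat_mem s v) \<and>
      real_mem s' = (real_mem s)(''R'' := (\<lambda>j l. real_mem s ''R'' j l +
        (if j < n \<and> l < n then (if j = l then 1 else 0) else 0)))"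
    by (rule accumulate_entries[where E = "\<lambda>p q. if p = q then 1 else 0"]) (simp_all add: simps, simp_all add: kronecker_exp_def)
  then obtain T1 u1 where r1: "runs (accumulate ''R'' (scalar ''p'') (scalar ''q'') kronecker_exp) s T1 u1" "T1 \<le> 200 * n\<^sup>2"
    and n1: "\<And>v. v \<noteq> ''p'' \<Longrightarrow> v \<noteq> ''q'' \<Longrightarrow> nat_mem u1 v = nat_mem s v"
    and m1': "real_mem u1 = (real_mem s)(''R'' := (\<lambda>j l. real_mem s ''R'' j l +
        (if j < n \<and> l < n then (if j = l then 1 else 0) else 0)))" by blast
  have m1: "real_mem u1 = (real_mem s)(''R'' := D 1)" unfolding m1' by (simp add: D_def zero)
  have "\<exists>T s'. runs (accumulate ''Y'' (scalar ''p'') (scalar ''q'') (RDiv kronecker_exp half_eps)) u1 T s' \<and>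
      T \<le> 200 * n\<^sup>2 \<and> (\<forall>v. v \<noteq> ''p'' \<longrightarrow> v \<noteq> ''q'' \<longrightarrow> nat_mem s' v = nat_mem s v) \<and>
      real_mem s' = (real_mem u1)(''Y'' := (\<lambda>j l. real_mem u1 ''Y'' j l +
        (if j < n \<and> l < n then (if j = l then 1 / (\<epsilon> / 2) else 0) else 0)))"
    by (rule accumulate_entries[where E = "\<lambda>p q. if p = q then 1 / (\<epsilon> / 2) else 0"])
      (simp_all add: simps n1 m1, simp_all add: kronecker_exp_def)
  then obtain T2 u2 where r2: "runs (accumulate ''Y'' (scalar ''p'') (scalar ''q'') (RDiv kronecker_exp half_eps)) u1 T2 u2"
      "T2 \<le> 200 * n\<^sup>2"
    and n2: "\<And>v. v \<noteq> ''p'' \<Longrightarrow> v \<noteq> ''q'' \<Longrightarrow> nat_mem u2 v = nat_mem s v"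
    and m2': "real_mem u2 = (real_mem u1)(''Y'' := (\<lambda>j l. real_mem u1 ''Y'' j l +
        (if j < n \<and> l < n then (if j = l then 1 / (\<epsilon> / 2) else 0) else 0)))" by blast
  have m2: "real_mem u2 = (real_mem s)(''R'' := D 1, ''Y'' := D (1 / (\<epsilon> / 2)))"
    unfolding m2' m1 by (auto simp: D_def zero fun_eq_iff)
  have "\<exists>T s'. runs (accumulate ''Z'' (scalar ''p'') (scalar ''q'') (RDiv kronecker_exp half_eps)) u2 T s' \<and>
      T \<le> 200 * n\<^sup>2 \<and> (\<forall>v. v \<noteq> ''p'' \<longrightarrow> v \<noteq> ''q'' \<longrightarrow> nat_mem s' v = nat_mem s v) \<and>
      real_mem s' = (real_mem u2)(''Z'' := (\<lambda>j l. real_mem u2 ''Z'' j l +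
        (if j < n \<and> l < n then (if j = l then 1 / (\<epsilon> / 2) else 0) else 0)))"
    by (rule accumulate_entries[where E = "\<lambda>p q. if p = q then 1 / (\<epsilon> / 2) else 0"])
      (simp_all add: simps n2 m2, simp_all add: kronecker_exp_def)
  then obtain T3 u3 where r3: "runs (accumulate ''Z'' (scalar ''p'') (scalar ''q'') (RDiv kronecker_exp half_eps)) u2 T3 u3"
      "T3 \<le> 200 * n\<^sup>2"
    and n3: "\<And>v. v \<noteq> ''p'' \<Longrightarrow> v \<noteq> ''q'' \<Longrightarrow> nat_mem u3 v = nat_mem s v"
    and m3': "real_mem u3 = (real_mem u2)(''Z'' := (\<lambda>j l. real_mem u2 ''Z'' j l +
        (if j < n \<and> l < n then (if j = l then 1 / (\<epsilon> / 2) else 0) else 0)))" by blast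
  have m3: "real_mem u3 = (real_mem s)(''R'' := D 1, ''Y'' := D (1 / (\<epsilon> / 2)), ''Z'' := D (1 / (\<epsilon> / 2)))"
    unfolding m3' m2 by (auto simp: D_def zero fun_eq_iff)
  \<comment> \<open>The contents of \<open>x\<close> and \<open>w\<close> are arbitrary, as no index
    has been chosen yet.\<close>
  have "sampling_invariant m n (\<epsilon> / 2) a 0 (D (1 / (\<epsilon> / 2))) (D (1 / (\<epsilon> / 2))) (D 1) 0 x w" for x w
    by (rule sampling_invariant_init[OF _ _ _ _ orth]) (use \<epsilon> in \<open>simp_all add: D_def\<close>)
  then have "loop_invariant m n \<epsilon> a 0 (write_nat ''i'' 0 0 u3)"
    by (simp add: loop_invariant_def nat_mem_write_nat n3 nats m3 A eps zero)
  then have "\<exists>T s'. runs (for_loop ''i'' ''m'' process_row) u3 T s' \<and>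
      T \<le> m * (2300 * n\<^sup>2 + 12) + 9 \<and> loop_invariant m n \<epsilon> a m s'"
  proof (rule for_loop_runs)
    fix k s' assume "loop_invariant m n \<epsilon> a k s'"
    then show "nat_mem s' ''i'' 0 = k \<and> nat_mem s' ''m'' 0 = m" by (simp add: loop_invariant_def)
  next
    fix k s' assume "k < m" "loop_invariant m n \<epsilon> a k s'"
    then show "\<exists>T s''. runs process_row s' T s'' \<and> T \<le> 2300 * n\<^sup>2 \<and> nat_mem s'' ''i'' 0 = k \<and>
        loop_invariant m n \<epsilon> a (Suc k) (write_nat ''i'' 0 (Suc k) s'')"
      using n(1) \<epsilon> by (intro process_row_runs)
  qed
  then obtain T4 out where r4: "runs (for_loop ''i'' ''m'' process_row) u3 T4 out"
      "T4 \<le> m * (2300 * n\<^sup>2 + 12) + 9" and inv: "loop_invariant m n \<epsilon> a m out" by blast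
  have run: "runs sparsify s (T1 + (T2 + (T3 + T4))) out"
    unfolding sparsify_def by (intro runs.Seq[OF r1(1)] runs.Seq[OF r2(1)] runs.Seq[OF r3(1)] r4(1))
  have "1 \<le> m" using n by simp
  have "m * 1 \<le> m * n\<^sup>2" "1 * n\<^sup>2 \<le> m * n\<^sup>2" "1 \<le> m * n\<^sup>2"
    using n \<open>1 \<le> m\<close> by (simp_all add: Suc_le_eq)
  moreover have "m * (2300 * n\<^sup>2 + 12) = 2300 * (m * n\<^sup>2) + 12 * m" by (simp add: algebra_simps)
  \<comment> \<open>The constants add up to \<open>600 + 2300 + 12 + 9 = 2921\<close>.\<close>
  ultimately have "T1 + (T2 + (T3 + T4)) \<le> 3000 * (m * n\<^sup>2)"
    using r1(2) r2(2) r3(2) r4(2) by linarith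
  with run inv show ?thesis unfolding s_def by blast
qed

section \<open>Operator norm of the symmetric error matrix, and the theorem\<close>

lemma operator_norm_le:
  assumes N: "N \<in> carrier_mat n n" and "0 < \<epsilon>"
    and sym: "\<And>p q. p < n \<Longrightarrow> q < n \<Longrightarrow> N $$ (p, q) = N $$ (q, p)"
    and quad: "\<And>v. \<bar>bil n (\<lambda>p q. N $$ (p, q)) v v\<bar> \<le> \<epsilon> * ip n v v"
  shows "operator_norm N \<le> \<epsilon>"
  unfolding operator_norm_def
\<comment> \<open>Bounding the supremum requires a nonempty unit ball; the zero vector witnesses
  this.\<close>
proof (rule cSUP_least)
  have "0\<^sub>v (dim_col N) \<in> {v \<in> carrier_vec (dim_col N). euclidean_norm v \<le> 1}"
    by (simp add: euclidean_norm_def)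
  then show "{v \<in> carrier_vec (dim_col N). euclidean_norm v \<le> 1} \<noteq> {}" by blast
next
  fix v assume "v \<in> {v \<in> carrier_vec (dim_col N). euclidean_norm v \<le> 1}"
  then have v: "v \<in> carrier_vec n" "euclidean_norm v \<le> 1" using N by auto
  have scalar_ip: "u \<bullet> u = ip n (\<lambda>p. u $ p) (\<lambda>p. u $ p)" if "u \<in> carrier_vec n" for u :: "real vec"
    using that by (simp add: scalar_prod_def ip_def atLeast0LessThan)
  have "(N *\<^sub>v v) \<bullet> (N *\<^sub>v v)
      = ip n (\<lambda>p. \<Sum>q<n. N $$ (p, q) * v $ q) (\<lambda>p. \<Sum>q<n. N $$ (p, q) * v $ q)"
    using N v by (simp add: scalar_prod_def ip_def atLeast0LessThan)
  also have "\<dots> \<le> \<epsilon>\<^sup>2 * ip n (\<lambda>p. v $ p) (\<lambda>p. v $ p)"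
    by (rule quadratic_form_bound[OF sym \<open>0 < \<epsilon>\<close> quad])
  also have "\<dots> \<le> \<epsilon>\<^sup>2 * 1"
    using v by (intro mult_left_mono) (simp_all add: euclidean_norm_def scalar_ip)
  finally have "(N *\<^sub>v v) \<bullet> (N *\<^sub>v v) \<le> \<epsilon>\<^sup>2" by simp
  then show "euclidean_norm (N *\<^sub>v v) \<le> \<epsilon>"
    unfolding euclidean_norm_def using \<open>0 < \<epsilon>\<close> by (intro real_le_lsqrt) simp_all
qed

theorem theorem6:
  shows "\<exists>(P :: program) (C :: real) (k :: nat). C > 0 \<and>
    (\<forall>(m :: nat) (n :: nat) (A :: real mat) (\<epsilon> :: real).
       1 \<le> n \<and> n \<le> m \<and> A \<in> carrier_mat m n \<and> transpose_mat A * A = 1\<^sub>m n \<and>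
       0 < \<epsilon> \<and> \<epsilon> < 1 \<longrightarrow>
       (\<exists>(T :: nat) (out :: memory).
          runs P (input_memory m n A \<epsilon>) T out \<and>
          real T \<le> C * (real m * real n ^ 2 * log_factor (real n) ^ 3 / \<epsilon> ^ 2) *
                    (loglog_factor (real n) * loglog_factor (1 / \<epsilon>)) ^ k \<and>
          real (output_length out) \<le> C * (real n * log_factor (real n) / \<epsilon> ^ 2) \<and>
          (\<forall>i < output_length out. output_index out i < m) \<and>
          operator_norm
            (square_mat_sum n
               (\<lambda>i. output_scalar out i \<cdot>\<^sub>m outer_product (Matrix.row A (output_index out i)))
               {..<output_length out}
             - 1\<^sub>m n) \<le> \<epsilon>))"
\<comment> \<open>The running time is at most \<open>3000 m n\<^sup>2\<close>, so the exponent 0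
  suffices for the doubly logarithmic factors; clipped logarithms are at least 1 and
  \<open>\<epsilon>\<^sup>2\<close> is at most 1.\<close>
proof (rule exI[of _ sparsify], rule exI[of _ 3000], rule exI[of _ 0], intro conjI allI impI)
  show "(0 :: real) < 3000" by simp
next
  fix m n :: nat and A :: "real mat" and \<epsilon> :: real
  assume asm: "1 \<le> n \<and> n \<le> m \<and> A \<in> carrier_mat m n \<and> transpose_mat A * A = 1\<^sub>m n \<and> 0 < \<epsilon> \<and> \<epsilon> < 1"
  then have n: "1 \<le> n" "n \<le> m" and A: "A \<in> carrier_mat m n" and AA: "transpose_mat A * A = 1\<^sub>m n"
    and \<epsilon>: "0 < \<epsilon>" "\<epsilon> < 1" by auto
  define a where "a = (\<lambda>j p. if j < m \<and> p < n then A $$ (j, p) else 0)"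
  have orth: "(\<Sum>j<m. a j p * a j q) = (if p = q then 1 else 0)" if "p < n" "q < n" for p q
  proof -
    have "(\<Sum>j<m. a j p * a j q) = (transpose_mat A * A) $$ (p, q)"
      using A that by (simp add: a_def scalar_prod_def atLeast0LessThan)
    with AA that show ?thesis by simp
  qed
  obtain T out where run: "runs sparsify (input_memory m n A \<epsilon>) T out" "T \<le> 3000 * (m * n\<^sup>2)"
    and inv: "loop_invariant m n \<epsilon> a m out"
    using sparsify_runs[OF n \<epsilon> a_def orth] by blast
  define t x w where "t = nat_mem out ''t'' 0" and "x = nat_mem out ''x''" and "w = (\<lambda>l. real_mem out ''s'' l 0)"
  obtain Y Z R where samp: "sampling_invariant m n (\<epsilon> / 2) a m Y Z R t x w"
    using inv by (auto simp: loop_invariant_def t_def x_def w_def)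
  have out: "output_length out = t" "output_index out = x" "output_scalar out = w"
    by (auto simp: output_length_def output_index_def output_scalar_def t_def x_def w_def)
  have x: "x l < m" if "l < t" for l using samp that by (auto simp: sampling_invariant_def)
  have ln: "1 \<le> log_factor (real n)" by (simp add: log_factor_def)
  have e2: "0 < \<epsilon>\<^sup>2" "\<epsilon>\<^sup>2 \<le> 1" using \<epsilon> by (simp_all add: power_le_one)
  define N where "N = square_mat_sum n (\<lambda>i. w i \<cdot>\<^sub>m outer_product (Matrix.row A (x i))) {..<t} - 1\<^sub>m n"
  have N: "N \<in> carrier_mat n n" by (simp add: N_def minus_carrier_mat)
  have entries: "N $$ (p, q) = (\<Sum>l<t. w l * a (x l) p * a (x l) q) - (if p = q then 1 else 0)"
    if "p < n" "q < n" for p q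
    using that A x by (auto simp: N_def square_mat_sum_def outer_product_def a_def intro!: sum.cong)
  have bil: "bil n (\<lambda>p q. N $$ (p, q)) v v = (\<Sum>l<t. w l * (ip n (a (x l)) v)\<^sup>2) - ip n v v" for v
  proof -
    have "bil n (\<lambda>p q. N $$ (p, q)) v v = bil n (\<lambda>p q. \<Sum>l<t. w l * a (x l) p * a (x l) q) v v
        - bil n (\<lambda>p q. if p = q then 1 else 0) v v"
      by (simp add: bil_def entries left_diff_distrib sum_subtractf)
    then show ?thesis
      by (simp add: bil_sum_rank_one[where a = "\<lambda>l. a (x l)" and c = w] bil_diagonal[where c = 1]
          power2_eq_square mult.assoc)
  qed
  have "operator_norm N \<le> \<epsilon>"
  proof (rule operator_norm_le[OF N \<epsilon>(1)])
    show "N $$ (p, q) = N $$ (q, p)" if "p < n" "q < n" for p q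
      using that by (simp add: entries mult_ac)
    \<comment> \<open>With \<delta> = \<open>\<epsilon> / 2\<close>, the final error
      \<open>2 \<delta>\<close> is exactly \<epsilon>.\<close>
    show "\<bar>bil n (\<lambda>p q. N $$ (p, q)) v v\<bar> \<le> \<epsilon> * ip n v v" for v
      using sampling_invariant_final[OF samp orth, of v] by (simp add: bil)
  qed
  moreover have "real T \<le> 3000 * (real m * real n ^ 2 * log_factor (real n) ^ 3 / \<epsilon> ^ 2) *
                    (loglog_factor (real n) * loglog_factor (1 / \<epsilon>)) ^ 0"
  proof -
    have "real T \<le> real (3000 * (m * n\<^sup>2))" using run(2) by (simp only: of_nat_le_iff)
    also have "\<dots> = 3000 * (real m * real n ^ 2 * 1 / 1)" by simp
    also have "\<dots> \<le> 3000 * (real m * real n ^ 2 * log_factor (real n) ^ 3 / \<epsilon> ^ 2)"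
      using ln e2 by (intro mult_left_mono frac_le mult_nonneg_nonneg) (auto simp: one_le_power)
    finally show ?thesis by simp
  qed
  moreover have "real t \<le> 3000 * (real n * log_factor (real n) / \<epsilon> ^ 2)"
  proof -
    \<comment> \<open>The sum in the estimator is empty after the last row, so the estimator bounds
      the number of indices itself.\<close>
    have "real t \<le> 4 * real n / (\<epsilon> / 2)\<^sup>2" using samp by (simp add: sampling_invariant_def)
    also have "\<dots> = 16 * (real n * 1 / \<epsilon>\<^sup>2)" by (simp add: power_divide)
    also have "\<dots> \<le> 3000 * (real n * log_factor (real n) / \<epsilon> ^ 2)"
      using ln e2 by (intro mult_mono divide_right_mono mult_left_mono) auto
    finally show ?thesis .
  qed
  ultimately show "\<exists>T out. runs sparsify (input_memory m n A \<epsilon>) T out \<and>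
          real T \<le> 3000 * (real m * real n ^ 2 * log_factor (real n) ^ 3 / \<epsilon> ^ 2) *
                    (loglog_factor (real n) * loglog_factor (1 / \<epsilon>)) ^ 0 \<and>
          real (output_length out) \<le> 3000 * (real n * log_factor (real n) / \<epsilon> ^ 2) \<and>
          (\<forall>i < output_length out. output_index out i < m) \<and>
          operator_norm
            (square_mat_sum n
               (\<lambda>i. output_scalar out i \<cdot>\<^sub>m outer_product (Matrix.row A (output_index out i)))
               {..<output_length out}
             - 1\<^sub>m n) \<le> \<epsilon>"
    using run(1) x unfolding out N_def[symmetric] by (intro exI[of _ T] exI[of _ out]) (auto simp: out N_def)
qed

end
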